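(* Let $A=KQ/I$ be a gentle algebra. Let $q$ be a positive integer and $l\in\mathbb N$, and put $d=\gcd(q,l)$. Then $$\phi_A(q,l)=\frac1q\sum_{c\mid d}\mu(c)\,\phi_{A^{(q/c)}}\Big(1,\ \frac{q+l}{c}-1\Big),$$ where $\mu$ is the Möbius function.
   Context: $K$ is an algebraically closed field; $\mathbb N=\{0,1,2,\dots\}$; $\gcd(q,0)=q$. A quiver $Q=(Q_0,Q_1,s,t)$ is finite. Paths are composed from left to right: $\alpha_1\cdots\alpha_l$ (arrows $\alpha_i$, $l\ge1$) is a path of length $l$ if $t(\alpha_i)=s(\alpha_{i+1})$; $e_a$ is the path of length $0$ at the vertex $a$. A bound quiver $(Q,I)$ is locally gentle if $I$ is an ideal of $KQ$ generated by a set of paths of length $2$, every vertex $a$ has in-degree $d_{\rm in}(a)\le 2$ and out-degree $d_{\rm out}(a)\le 2$, and for every arrow $\alpha$ there is at most one arrow $\beta$ with $t(\beta)=s(\alpha)$, $\beta\alpha\in I$; at most one with $t(\beta)=s(\alpha)$, $\beta\alpha\notin I$; at most one with $s(\beta)=t(\alpha)$, $\alpha\beta\in I$; at most one with $s(\beta)=t(\alpha)$, $\alpha\beta\notin I$. Put $A=KQ/I$. A path in $A$ is a path of $Q$ not in $I$. An antipath in $A$ is a path $\alpha_1\cdots\alpha_l$ ($l\ge 1$) of $Q$ with all $\alpha_i\alpha_{i+1}\in I$. $A$ is gentle if it is locally gentle and $\dim_K A<\infty$ (equivalently, there is no cyclic sequence of arrows all of whose consecutive length-two products are paths not in $I$).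 Standing assumptions: $Q$ is connected and $Q_1\ne\emptyset$. Blossoming: $(Q^{\rm bl},I^{\rm bl})$ is obtained by adding, for each $v\in Q_0$, $2-d_{\rm in}(v)$ incoming arrows from new pairwise distinct vertices and $2-d_{\rm out}(v)$ outgoing arrows to new pairwise distinct vertices, and adding length-two relations so that the result is locally gentle and $\alpha\beta\in I\Leftrightarrow\alpha\beta\in I^{\rm bl}$ for $\alpha,\beta\in Q_1$ (unique up to isomorphism). Put $A^{\rm bl}=KQ^{\rm bl}/I^{\rm bl}$ and $d_A=2|Q_0|-|Q_1|$. The new vertices are $d_A$ sources $s_1,\dots,s_{d_A}$ and $d_A$ sinks $t_1,\dots,t_{d_A}$; $\sigma_p$ is the unique arrow starting at $s_p$ and $\tau_p$ the unique arrow ending at $t_p$. A (anti)path is maximal if it cannot be extended by an arrow on either side to a longer (anti)path. The labeling is chosen so that for each $p$ there is a maximal path in $A^{\rm bl}$ from $s_p$ to $t_p$. Finite gentle repetition: for $k\ge1$, $A^{(k)}=KQ^{(k)}/I^{(k)}$, where $Q^{(k)}$ has vertices $a^{[i]}$ ($a\in Q_0$, $1\le i\le k$), arrows $\alpha^{[i]}:s(\alpha)^{[i]}\to t(\alpha)^{[i]}$ ($\alpha\in Q_1$, $1\le i\le k$), and connecting arrows $\varpi_p^{[i]}: s(\tau_p)^{[i]}\to t(\sigma_p)^{[i+1]}$ ($1\le p\le d_A$, $1\le i<k$); $I^{(k)}$ is generated by the $\alpha^{[i]}\beta^{[i]}$ with $\alpha\beta\in I$, the $\alpha^{[i]}\varpi_p^{[i]}$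 with $\alpha\tau_p\in I^{\rm bl}$, the $\varpi_p^{[i]}\beta^{[i+1]}$ with $\sigma_p\beta\in I^{\rm bl}$, and the $\varpi_p^{[i]}\varpi_{p'}^{[i+1]}$ with $\sigma_p\tau_{p'}\in I^{\rm bl}$ (composable arrows, $\alpha,\beta\in Q_1$). If $A$ is gentle, so is $A^{(k)}$. Avella-Alaminos–Geiss (AG) invariants of gentle $A$: for each $p$ there is a unique maximal antipath in $A^{\rm bl}$ ending at $t_p$; it starts at some $s_{\Phi(p)}$, which defines a permutation $\Phi=\Phi_A$ of $\{1,\dots,d_A\}$, and it has the form $\sigma_{\Phi(p)}\delta_p\tau_p$ with $\delta_p$ an antipath in $A$ or a trivial path $e_a$ (of length $0$). The AG-orbits are the orbits $\mathcal O$ of $\Phi$ acting on $\{\delta_1,\dots,\delta_{d_A}\}$ by $\delta_p\mapsto\delta_{\Phi(p)}$; the type of $\mathcal O$ is $(q,l)$ with $q=|\mathcal O|$ and $l$ the sum of the lengths of the elements of $\mathcal O$. For $q\ge1$, $l\in\mathbb N$, $\phi_A(q,l)$ is the number of AG-orbits of type $(q,l)$ in $A$. *)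

theory Defs
  imports
    "Graph_Theory.Graph_Theory"
    "HOL-Algebra.Ideal"
    "HOL-Combinatorics.Orbits"
    "HOL-Computational_Algebra.Computational_Algebra"
    "HOL-Library.Poly_Mapping"
begin

section \<open>Path algebras of quivers\<close>

text \<open>
  A finite quiver is a finite directed multigraph (\<open>fin_digraph\<close>; loops and parallel arcs are
  allowed), with \<open>tail\<close> as source map and \<open>head\<close> as target map. A path is given by its starting
  vertex and its list of arrows, from left to right; the vertex makes the path of length 0 at \<open>a\<close>
  the pair \<open>(a, [])\<close>.
\<close>

type_synonym ('v, 'a) path = "'v \<times> 'a list"

definition paths :: "('v, 'a) pre_digraph \<Rightarrow> ('v, 'a) path set" where
  "paths Q = {(u, xs). \<exists>v. pre_digraph.awalk Q u xs v}"

definition path_target :: "('v, 'a) pre_digraph \<Rightarrow> ('v, 'a) path \<Rightarrow> 'v" where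
  "path_target Q = (\<lambda>(u, xs). last (pre_digraph.awalk_verts Q u xs))"

definition path_mult :: "('v, 'a) pre_digraph \<Rightarrow>
    (('v, 'a) path \<Rightarrow>\<^sub>0 'k::field) \<Rightarrow> (('v, 'a) path \<Rightarrow>\<^sub>0 'k) \<Rightarrow> (('v, 'a) path \<Rightarrow>\<^sub>0 'k)" where
  "path_mult Q f g =
     (\<Sum>x\<in>Poly_Mapping.keys f. \<Sum>y\<in>Poly_Mapping.keys g.
        if path_target Q x = fst y
        then Poly_Mapping.single (fst x, snd x @ snd y)
               (Poly_Mapping.lookup f x * Poly_Mapping.lookup g y)
        else 0)"

definition path_algebra :: "('v, 'a) pre_digraph \<Rightarrow> (('v, 'a) path \<Rightarrow>\<^sub>0 'k::field) ring" where
  "path_algebra Q =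
     \<lparr>carrier = {f. Poly_Mapping.keys f \<subseteq> paths Q},
      monoid.mult = path_mult Q,
      one = (\<Sum>v\<in>verts Q. Poly_Mapping.single (v, []) 1),
      ring.zero = 0,
      add = (+)\<rparr>"

definition path_elem :: "('v, 'a) path \<Rightarrow> (('v, 'a) path \<Rightarrow>\<^sub>0 'k::field)" where
  "path_elem x = Poly_Mapping.single x 1"

definition path_scale :: "'k::field \<Rightarrow> (('v, 'a) path \<Rightarrow>\<^sub>0 'k) \<Rightarrow> (('v, 'a) path \<Rightarrow>\<^sub>0 'k)" where
  "path_scale c f = Poly_Mapping.map ((*) c) f"


subsection \<open>Basic facts\<close>

lemma path_mult_superset:
  assumes "finite X" "finite Y" "Poly_Mapping.keys f \<subseteq> X" "Poly_Mapping.keys g \<subseteq> Y"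
  shows "path_mult Q f g =
     (\<Sum>x\<in>X. \<Sum>y\<in>Y.
        if path_target Q x = fst y
        then Poly_Mapping.single (fst x, snd x @ snd y)
               (Poly_Mapping.lookup f x * Poly_Mapping.lookup g y)
        else 0)"
proof -
  have "path_mult Q f g = (\<Sum>x\<in>Poly_Mapping.keys f. \<Sum>y\<in>Y.
        if path_target Q x = fst y
        then Poly_Mapping.single (fst x, snd x @ snd y)
               (Poly_Mapping.lookup f x * Poly_Mapping.lookup g y)
        else 0)"
    unfolding path_mult_def using assms
    by (intro sum.cong refl sum.mono_neutral_left) (auto simp: in_keys_iff)
  also have "\<dots> = (\<Sum>x\<in>X. \<Sum>y\<in>Y.
        if path_target Q x = fst y
        then Poly_Mapping.single (fst x, snd x @ snd y)
               (Poly_Mapping.lookup f x * Poly_Mapping.lookup g y)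
        else 0)"
    using assms by (intro sum.mono_neutral_left) (auto simp: in_keys_iff intro!: sum.neutral)
  finally show ?thesis .
qed

lemma path_mult_add_left: "path_mult Q (f + g) h = path_mult Q f h + path_mult Q g h"
proof -
  let ?X = "Poly_Mapping.keys f \<union> Poly_Mapping.keys g"
  have sub: "Poly_Mapping.keys (f + g) \<subseteq> ?X" by (rule Poly_Mapping.keys_add)
  show ?thesis
    using sub by (simp add: path_mult_superset[where X="?X" and Y="Poly_Mapping.keys h"]
      lookup_add distrib_right single_add sum.distrib[symmetric] if_distrib cong: if_cong)
qed

lemma path_mult_add_right: "path_mult Q h (f + g) = path_mult Q h f + path_mult Q h g"
proof -
  let ?X = "Poly_Mapping.keys f \<union> Poly_Mapping.keys g"
  have sub: "Poly_Mapping.keys (f + g) \<subseteq> ?X" by (rule Poly_Mapping.keys_add)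
  show ?thesis
    using sub by (simp add: path_mult_superset[where Y="?X" and X="Poly_Mapping.keys h"]
      lookup_add distrib_left single_add sum.distrib[symmetric] if_distrib cong: if_cong)
qed

lemma path_mult_0 [simp]: "path_mult Q 0 f = 0" "path_mult Q f 0 = 0"
  by (simp_all add: path_mult_def)

lemma path_mult_single: "path_mult Q (Poly_Mapping.single x a) (Poly_Mapping.single y b) =
   (if path_target Q x = fst y then Poly_Mapping.single (fst x, snd x @ snd y) (a * b) else 0)"
  by (subst path_mult_superset[where X="{x}" and Y="{y}"]) auto

lemma path_mult_sum_left: "path_mult Q (sum f S) h = (\<Sum>s\<in>S. path_mult Q (f s) h)"
  by (induction S rule: infinite_finite_induct) (auto simp: path_mult_add_left)

lemma path_mult_sum_right: "path_mult Q h (sum f S) = (\<Sum>s\<in>S. path_mult Q h (f s))"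
  by (induction S rule: infinite_finite_induct) (auto simp: path_mult_add_right)

lemma poly_mapping_expansion:
  "f = (\<Sum>x\<in>Poly_Mapping.keys f. Poly_Mapping.single x (Poly_Mapping.lookup f x))"
  by (rule poly_mapping_eqI) (auto simp: lookup_sum lookup_single when_def in_keys_iff)

lemma path_target_simps [simp]:
  "path_target Q (u, []) = u"
  "path_target Q (u, x # xs) = path_target Q (head Q x, xs)"
  by (auto simp: path_target_def pre_digraph.awalk_verts.simps) (cases xs; auto simp: pre_digraph.awalk_verts.simps)+

lemma paths_iff:
  "(u, xs) \<in> paths Q \<longleftrightarrow> u \<in> verts Q \<and> set xs \<subseteq> arcs Q \<and> pre_digraph.cas Q u xs (path_target Q (u, xs))"
proof -
  have "pre_digraph.cas Q u xs v \<Longrightarrow> v = path_target Q (u, xs)" for v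
    by (induction xs arbitrary: u) (auto simp: pre_digraph.cas.simps)
  thus ?thesis by (auto simp: paths_def pre_digraph.awalk_def)
qed

lemma path_target_append: "path_target Q (u, xs @ ys) = path_target Q (path_target Q (u, xs), ys)"
  by (induction xs arbitrary: u) auto

lemma cas_append: "pre_digraph.cas Q u (xs @ ys) v \<longleftrightarrow>
   pre_digraph.cas Q u xs (path_target Q (u,xs)) \<and> pre_digraph.cas Q (path_target Q (u,xs)) ys v"
  by (induction xs arbitrary: u) (auto simp: pre_digraph.cas.simps)

lemma paths_append:
  assumes "(u, xs) \<in> paths Q" "(path_target Q (u, xs), ys) \<in> paths Q"
  shows "(u, xs @ ys) \<in> paths Q"
  using assms by (auto simp: paths_iff cas_append path_target_append)

lemma paths_target_in_verts:
  assumes "fin_digraph Q" "x \<in> paths Q" shows "path_target Q x \<in> verts Q"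
proof -
  interpret fin_digraph Q by fact
  obtain u xs where x: "x = (u, xs)" by (cases x)
  have "u \<in> verts Q \<Longrightarrow> set xs \<subseteq> arcs Q \<Longrightarrow> path_target Q (u, xs) \<in> verts Q"
    by (induction xs arbitrary: u) auto
  thus ?thesis using assms x by (auto simp: paths_iff)
qed

lemma path_mult_keys:
  "Poly_Mapping.keys (path_mult Q f g) \<subseteq>
    {(fst x, snd x @ snd y) | x y. x \<in> Poly_Mapping.keys f \<and> y \<in> Poly_Mapping.keys g \<and> path_target Q x = fst y}"
proof
  fix z assume "z \<in> Poly_Mapping.keys (path_mult Q f g)"
  hence "Poly_Mapping.lookup (path_mult Q f g) z \<noteq> 0" by (simp add: in_keys_iff)
  then obtain x y where "x \<in> Poly_Mapping.keys f" "y \<in> Poly_Mapping.keys g"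
    "Poly_Mapping.lookup (if path_target Q x = fst y
        then Poly_Mapping.single (fst x, snd x @ snd y)
               (Poly_Mapping.lookup f x * Poly_Mapping.lookup g y)
        else 0) z \<noteq> 0"
    unfolding path_mult_def lookup_sum by (meson sum.neutral)
  moreover from this have "path_target Q x = fst y" "z = (fst x, snd x @ snd y)"
    by (auto simp: lookup_single when_def split: if_splits)
  ultimately show "z \<in> {(fst x, snd x @ snd y) | x y. x \<in> Poly_Mapping.keys f \<and> y \<in> Poly_Mapping.keys g \<and> path_target Q x = fst y}"
    by blast
qed

lemma path_mult_assoc: "path_mult Q (path_mult Q f g) h = path_mult Q f (path_mult Q g h)"
proof -
  have *: "path_mult Q (path_mult Q (Poly_Mapping.single x a) (Poly_Mapping.single y b)) (Poly_Mapping.single z c)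
     = path_mult Q (Poly_Mapping.single x a) (path_mult Q (Poly_Mapping.single y b) (Poly_Mapping.single z c))"
     for x y z a b c
    by (cases x; cases y; cases z) (auto simp: path_mult_single path_target_append mult.assoc)
  show ?thesis
    apply (subst (1 2) poly_mapping_expansion[of f], subst (1 2) poly_mapping_expansion[of g], subst (1 2) poly_mapping_expansion[of h])
    apply (simp only: path_mult_sum_left path_mult_sum_right *)
    done
qed

lemma path_mult_carrier:
  assumes "Poly_Mapping.keys f \<subseteq> paths Q" "Poly_Mapping.keys g \<subseteq> paths Q"
  shows "Poly_Mapping.keys (path_mult Q f g) \<subseteq> paths Q"
  using path_mult_keys[of Q f g] assms by (fastforce intro: paths_append)

text \<open>\<open>genideal\<close> is an intersection over the ideals of a ring, so it is only meaningful because of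
  the following fact.\<close>

lemma path_algebra_ring:
  fixes Q :: "('v, 'a) pre_digraph"
  assumes "fin_digraph Q"
  shows "ring (path_algebra Q :: (('v, 'a) path \<Rightarrow>\<^sub>0 'k::field) ring)"
proof (rule ringI)
  interpret fin_digraph Q by fact
  show "abelian_group (path_algebra Q :: (('v, 'a) path \<Rightarrow>\<^sub>0 'k::field) ring)"
  proof (rule abelian_groupI)
    fix f :: "('v, 'a) path \<Rightarrow>\<^sub>0 'k" assume "f \<in> carrier (path_algebra Q)"
    thus "\<exists>g\<in>carrier (path_algebra Q). g \<oplus>\<^bsub>path_algebra Q\<^esub> f = \<zero>\<^bsub>path_algebra Q\<^esub>"
      by (intro bexI[of _ "-f"]) (auto simp: path_algebra_def)
  qed (use Poly_Mapping.keys_add in \<open>fastforce simp: path_algebra_def add_ac\<close>)+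
  have keys1: "Poly_Mapping.keys (\<Sum>v\<in>verts Q. Poly_Mapping.single (v, []) (1::'k)) \<subseteq> paths Q"
    by (rule order.trans[OF Poly_Mapping.keys_sum]) (auto simp: paths_iff pre_digraph.cas.simps)
  have one: "path_mult Q (\<Sum>v\<in>verts Q. Poly_Mapping.single (v, []) 1) f = f"
            "path_mult Q f (\<Sum>v\<in>verts Q. Poly_Mapping.single (v, []) 1) = f"
    if f: "Poly_Mapping.keys f \<subseteq> paths Q" for f :: "('v, 'a) path \<Rightarrow>\<^sub>0 'k"
  proof -
    have "path_mult Q (\<Sum>v\<in>verts Q. Poly_Mapping.single (v, []) 1) f =
      (\<Sum>x\<in>Poly_Mapping.keys f. \<Sum>v\<in>verts Q. path_mult Q (Poly_Mapping.single (v, []) 1) (Poly_Mapping.single x (Poly_Mapping.lookup f x)))"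
      by (subst poly_mapping_expansion[of f], simp only: path_mult_sum_left path_mult_sum_right)
    also have "\<dots> = (\<Sum>x\<in>Poly_Mapping.keys f. Poly_Mapping.single x (Poly_Mapping.lookup f x))"
      using f by (intro sum.cong refl) (auto simp: path_mult_single paths_iff)
    finally show "path_mult Q (\<Sum>v\<in>verts Q. Poly_Mapping.single (v, []) 1) f = f"
      by (simp add: poly_mapping_expansion[symmetric])
    have "path_mult Q f (\<Sum>v\<in>verts Q. Poly_Mapping.single (v, []) 1) =
      (\<Sum>x\<in>Poly_Mapping.keys f. \<Sum>v\<in>verts Q. path_mult Q (Poly_Mapping.single x (Poly_Mapping.lookup f x)) (Poly_Mapping.single (v, []) 1))"
      by (subst poly_mapping_expansion[of f], simp only: path_mult_sum_left path_mult_sum_right)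
         (rule sum.swap)
    also have "\<dots> = (\<Sum>x\<in>Poly_Mapping.keys f. Poly_Mapping.single x (Poly_Mapping.lookup f x))"
      using f paths_target_in_verts[OF assms] by (intro sum.cong refl) (auto simp: path_mult_single)
    finally show "path_mult Q f (\<Sum>v\<in>verts Q. Poly_Mapping.single (v, []) 1) = f"
      by (simp add: poly_mapping_expansion[symmetric])
  qed
  show "Group.monoid (path_algebra Q :: (('v, 'a) path \<Rightarrow>\<^sub>0 'k::field) ring)"
    by (rule monoidI) (use keys1 one path_mult_carrier[of _ Q] in \<open>simp_all add: path_algebra_def path_mult_assoc\<close>)
qed (auto simp: path_algebra_def path_mult_add_left path_mult_add_right)

lemma path_scale_module: "module (path_scale :: 'k::field \<Rightarrow> (('v, 'a) path \<Rightarrow>\<^sub>0 'k) \<Rightarrow> _)"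
proof -
  have [simp]: "Poly_Mapping.lookup (path_scale c f) x = c * Poly_Mapping.lookup f x"
    for c :: 'k and f :: "('v, 'a) path \<Rightarrow>\<^sub>0 'k" and x
    by (simp add: path_scale_def Poly_Mapping.map.rep_eq when_def)
  show ?thesis
    by unfold_locales (auto intro!: poly_mapping_eqI simp: lookup_add algebra_simps)
qed

text \<open>A path that lies in the ideal generated by a set of paths of length 2 contains one of them; in
  particular, the paths of length 2 in the ideal are exactly the generators.\<close>

lemma path_elem_in_Idl:
  fixes R :: "('v, 'a) path set"
  assumes "fin_digraph Q" "R \<subseteq> {x \<in> paths Q. length (snd x) = 2}"
    and "(path_elem x :: ('v, 'a) path \<Rightarrow>\<^sub>0 'k::field) \<in> Idl\<^bsub>path_algebra Q\<^esub> (path_elem ` R)"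
  obtains us r vs where "snd x = us @ snd r @ vs" "r \<in> R"
proof -
  interpret ring "path_algebra Q :: (('v, 'a) path \<Rightarrow>\<^sub>0 'k) ring" by (rule path_algebra_ring) fact
  define C where "C = {x :: ('v, 'a) path. \<exists>us r vs. snd x = us @ snd r @ vs \<and> r \<in> R}"
  define J where "J = {f :: ('v, 'a) path \<Rightarrow>\<^sub>0 'k. Poly_Mapping.keys f \<subseteq> paths Q \<inter> C}"
  have C: "(u, xs @ ys) \<in> C" if "(v, xs) \<in> C \<or> (w, ys) \<in> C" for u v w xs ys
    using that unfolding C_def mem_Collect_eq snd_conv
    by (metis append.assoc)
  have mult: "path_mult Q f g \<in> J" if "Poly_Mapping.keys f \<subseteq> paths Q" "Poly_Mapping.keys g \<subseteq> paths Q"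
      "f \<in> J \<or> g \<in> J" for f g
  proof -
    have "Poly_Mapping.keys (path_mult Q f g) \<subseteq> C"
    proof
      fix z assume "z \<in> Poly_Mapping.keys (path_mult Q f g)"
      then obtain x y where "z = (fst x, snd x @ snd y)" "x \<in> Poly_Mapping.keys f" "y \<in> Poly_Mapping.keys g"
        using path_mult_keys[of Q f g] by blast
      thus "z \<in> C" using that(3) C[of "fst x" "snd x" "fst y" "snd y" "fst x"] by (auto simp: J_def)
    qed
    thus ?thesis using that path_mult_carrier[of f Q g] by (auto simp: J_def)
  qed
  have "ideal J (path_algebra Q)"
  proof (rule idealI)
    show "subgroup J (add_monoid (path_algebra Q))"
    proof (rule add.subgroupI)
      fix f assume f: "f \<in> J"
      have "f \<in> carrier (path_algebra Q)" "-f \<in> carrier (path_algebra Q)"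
        using f by (auto simp: J_def path_algebra_def)
      hence "\<ominus>\<^bsub>path_algebra Q\<^esub> f = - f"
        by (intro minus_equality) (auto simp: path_algebra_def)
      thus "\<ominus>\<^bsub>path_algebra Q\<^esub> f \<in> J" using f by (simp add: J_def)
    next
      show "J \<subseteq> carrier (path_algebra Q)" by (auto simp: J_def path_algebra_def)
      show "J \<noteq> {}" by (auto simp: J_def intro: exI[of _ 0])
    next
      fix f g assume "f \<in> J" "g \<in> J"
      thus "f \<oplus>\<^bsub>path_algebra Q\<^esub> g \<in> J" using Poly_Mapping.keys_add[of f g]
        by (auto simp: J_def path_algebra_def)
    qed
  qed (use mult ring_axioms in \<open>auto simp: path_algebra_def J_def\<close>)
  moreover have "path_elem ` R \<subseteq> J"
  proof -
    have "r \<in> C" if "r \<in> R" for r unfolding C_def using that by (intro CollectI exI[of _ "[]"] exI[of _ r]) auto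
    thus ?thesis using assms(2) by (auto simp: J_def path_elem_def)
  qed
  ultimately have "path_elem x \<in> J" using assms(3) unfolding genideal_def by blast
  thus ?thesis using that by (auto simp: J_def path_elem_def C_def)
qed


section \<open>Gentle bound quivers\<close>

record (overloaded) ('v, 'a, 'k) bound_quiver =
  quiver :: "('v, 'a) pre_digraph"
  ideal_of :: "(('v, 'a) path \<Rightarrow>\<^sub>0 'k::field) set"

text \<open>
  \<open>zero_product A \<alpha> \<beta>\<close> and \<open>nonzero_product A \<alpha> \<beta>\<close> both include that \<open>\<alpha>\<close> and \<open>\<beta>\<close> are
  composable, so they are not complementary.
\<close>

definition composable :: "('v, 'a, 'k::field) bound_quiver \<Rightarrow> 'a \<Rightarrow> 'a \<Rightarrow> bool" where
  "composable A \<alpha> \<beta> \<longleftrightarrow>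
     \<alpha> \<in> arcs (quiver A) \<and> \<beta> \<in> arcs (quiver A) \<and> head (quiver A) \<alpha> = tail (quiver A) \<beta>"

definition zero_product :: "('v, 'a, 'k::field) bound_quiver \<Rightarrow> 'a \<Rightarrow> 'a \<Rightarrow> bool" where
  "zero_product A \<alpha> \<beta> \<longleftrightarrow>
     composable A \<alpha> \<beta> \<and> path_elem (tail (quiver A) \<alpha>, [\<alpha>, \<beta>]) \<in> ideal_of A"

definition nonzero_product :: "('v, 'a, 'k::field) bound_quiver \<Rightarrow> 'a \<Rightarrow> 'a \<Rightarrow> bool" where
  "nonzero_product A \<alpha> \<beta> \<longleftrightarrow>
     composable A \<alpha> \<beta> \<and> path_elem (tail (quiver A) \<alpha>, [\<alpha>, \<beta>]) \<notin> ideal_of A"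

definition locally_gentle :: "('v, 'a, 'k::field) bound_quiver \<Rightarrow> bool" where
  "locally_gentle A \<longleftrightarrow>
     fin_digraph (quiver A) \<and>
     (\<exists>R \<subseteq> {x \<in> paths (quiver A). length (snd x) = 2}.
        ideal_of A = Idl\<^bsub>path_algebra (quiver A)\<^esub> (path_elem ` R)) \<and>
     (\<forall>v \<in> verts (quiver A). in_degree (quiver A) v \<le> 2 \<and> out_degree (quiver A) v \<le> 2) \<and>
     (\<forall>\<alpha> \<in> arcs (quiver A).
        (\<exists>\<^sub>\<le>\<^sub>1\<beta>. zero_product A \<beta> \<alpha>) \<and> (\<exists>\<^sub>\<le>\<^sub>1\<beta>. nonzero_product A \<beta> \<alpha>) \<and>
        (\<exists>\<^sub>\<le>\<^sub>1\<beta>. zero_product A \<alpha> \<beta>) \<and> (\<exists>\<^sub>\<le>\<^sub>1\<beta>. nonzero_product A \<alpha> \<beta>))"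

text \<open>
  \<open>K Q / I\<close> is finite-dimensional iff \<open>K Q\<close> is spanned by \<open>I\<close> together with finitely many elements
  (representatives of a finite spanning set of the quotient).
\<close>

definition finite_dimensional :: "('v, 'a, 'k::field) bound_quiver \<Rightarrow> bool" where
  "finite_dimensional A \<longleftrightarrow>
     (\<exists>B. finite B \<and> B \<subseteq> carrier (path_algebra (quiver A)) \<and>
        carrier (path_algebra (quiver A)) \<subseteq> module.span path_scale (ideal_of A \<union> B))"

definition gentle :: "('v, 'a, 'k::field) bound_quiver \<Rightarrow> bool" where
  "gentle A \<longleftrightarrow> locally_gentle A \<and> finite_dimensional A"

definition nonzero_path :: "('v, 'a, 'k::field) bound_quiver \<Rightarrow> ('v, 'a) path \<Rightarrow> bool" where
  "nonzero_path A x \<longleftrightarrow> x \<in> paths (quiver A) \<and> path_elem x \<notin> ideal_of A"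

definition antipath :: "('v, 'a, 'k::field) bound_quiver \<Rightarrow> ('v, 'a) path \<Rightarrow> bool" where
  "antipath A x \<longleftrightarrow> x \<in> paths (quiver A) \<and> snd x \<noteq> [] \<and> successively (zero_product A) (snd x)"

definition maximal :: "('v, 'a, 'k::field) bound_quiver \<Rightarrow> (('v, 'a) path \<Rightarrow> bool) \<Rightarrow>
    ('v, 'a) path \<Rightarrow> bool" where
  "maximal A P = (\<lambda>(u, xs). P (u, xs) \<and>
     (\<forall>\<alpha> \<in> arcs (quiver A). head (quiver A) \<alpha> = u \<longrightarrow> \<not> P (tail (quiver A) \<alpha>, \<alpha> # xs)) \<and>
     (\<forall>\<alpha> \<in> arcs (quiver A). \<not> P (u, xs @ [\<alpha>])))"


section \<open>Blossoming\<close>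

datatype 'v blossom_vertex = Old (base: 'v) | New_Source 'v nat | New_Sink 'v nat

datatype ('v, 'a) blossom_arrow = Old_Arrow 'a | New_In 'v nat | New_Out 'v nat

definition blossom_sources :: "('v, 'a) pre_digraph \<Rightarrow> 'v blossom_vertex set" where
  "blossom_sources Q = {New_Source v i | v i. v \<in> verts Q \<and> i < 2 - in_degree Q v}"

definition blossom_sinks :: "('v, 'a) pre_digraph \<Rightarrow> 'v blossom_vertex set" where
  "blossom_sinks Q = {New_Sink v i | v i. v \<in> verts Q \<and> i < 2 - out_degree Q v}"

definition blossom_quiver ::
    "('v, 'a) pre_digraph \<Rightarrow> ('v blossom_vertex, ('v, 'a) blossom_arrow) pre_digraph" where
  "blossom_quiver Q =
     \<lparr>verts = Old ` verts Q \<union> blossom_sources Q \<union> blossom_sinks Q,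
      arcs = Old_Arrow ` arcs Q \<union>
             {New_In v i | v i. v \<in> verts Q \<and> i < 2 - in_degree Q v} \<union>
             {New_Out v i | v i. v \<in> verts Q \<and> i < 2 - out_degree Q v},
      tail = (\<lambda>\<alpha>. case \<alpha> of Old_Arrow \<beta> \<Rightarrow> Old (tail Q \<beta>)
                          | New_In v i \<Rightarrow> New_Source v i
                          | New_Out v i \<Rightarrow> Old v),
      head = (\<lambda>\<alpha>. case \<alpha> of Old_Arrow \<beta> \<Rightarrow> Old (head Q \<beta>)
                          | New_In v i \<Rightarrow> Old v
                          | New_Out v i \<Rightarrow> New_Sink v i)\<rparr>"

definition is_blossoming :: "('v, 'a, 'k::field) bound_quiver \<Rightarrow>
    ('v blossom_vertex, ('v, 'a) blossom_arrow, 'k) bound_quiver \<Rightarrow> bool" where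
  "is_blossoming A A_bl \<longleftrightarrow>
     quiver A_bl = blossom_quiver (quiver A) \<and>
     locally_gentle A_bl \<and>
     (\<forall>\<alpha> \<beta>. composable A \<alpha> \<beta> \<longrightarrow>
        (zero_product A \<alpha> \<beta> \<longleftrightarrow> zero_product A_bl (Old_Arrow \<alpha>) (Old_Arrow \<beta>)))"

text \<open>The subtraction does not truncate: in a locally gentle quiver in-degrees are at most 2.\<close>

definition defect :: "('v, 'a, 'k::field) bound_quiver \<Rightarrow> nat" where
  "defect A = 2 * card (verts (quiver A)) - card (arcs (quiver A))"

text \<open>
  The relations at a new arrow and the numbering of the new vertices involve choices. A labelled
  blossoming records one such choice; results are stated for all of them.
\<close>

record (overloaded) ('v, 'a, 'k) blossoming =
  blossomed :: "('v blossom_vertex, ('v, 'a) blossom_arrow, 'k::field) bound_quiver"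
  source_label :: "nat \<Rightarrow> 'v blossom_vertex"
  sink_label :: "nat \<Rightarrow> 'v blossom_vertex"

definition labelled_blossoming ::
    "('v, 'a, 'k::field) bound_quiver \<Rightarrow> ('v, 'a, 'k) blossoming \<Rightarrow> bool" where
  "labelled_blossoming A B \<longleftrightarrow>
     is_blossoming A (blossomed B) \<and>
     bij_betw (source_label B) {1..defect A} (blossom_sources (quiver A)) \<and>
     bij_betw (sink_label B) {1..defect A} (blossom_sinks (quiver A)) \<and>
     (\<forall>p \<in> {1..defect A}. \<exists>xs.
        maximal (blossomed B) (nonzero_path (blossomed B)) (source_label B p, xs) \<and>
        path_target (quiver (blossomed B)) (source_label B p, xs) = sink_label B p)"

definition sigma :: "('v, 'a, 'k::field) blossoming \<Rightarrow> nat \<Rightarrow> ('v, 'a) blossom_arrow" where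
  "sigma B p = (THE \<alpha>. \<alpha> \<in> arcs (quiver (blossomed B)) \<and>
                        tail (quiver (blossomed B)) \<alpha> = source_label B p)"

definition tau :: "('v, 'a, 'k::field) blossoming \<Rightarrow> nat \<Rightarrow> ('v, 'a) blossom_arrow" where
  "tau B p = (THE \<alpha>. \<alpha> \<in> arcs (quiver (blossomed B)) \<and>
                      head (quiver (blossomed B)) \<alpha> = sink_label B p)"


section \<open>Finite gentle repetitions\<close>

text \<open>\<open>Copy \<alpha> i\<close> is the \<open>i\<close>-th copy of \<open>\<alpha>\<close>; \<open>Conn p i\<close> is the connecting arrow with label \<open>p\<close>
  from the \<open>i\<close>-th to the \<open>(i+1)\<close>-st copy.\<close>

datatype 'a repetition_arrow = Copy 'a nat | Conn nat nat

definition repetition_quiver :: "('v, 'a, 'k::field) bound_quiver \<Rightarrow> ('v, 'a, 'k) blossoming \<Rightarrow>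
    nat \<Rightarrow> ('v \<times> nat, 'a repetition_arrow) pre_digraph" where
  "repetition_quiver A B k =
     \<lparr>verts = verts (quiver A) \<times> {1..k},
      arcs = {Copy \<alpha> i | \<alpha> i. \<alpha> \<in> arcs (quiver A) \<and> i \<in> {1..k}} \<union>
             {Conn p i | p i. p \<in> {1..defect A} \<and> i \<in> {1..<k}},
      tail = (\<lambda>\<alpha>. case \<alpha> of Copy \<beta> i \<Rightarrow> (tail (quiver A) \<beta>, i)
                          | Conn p i \<Rightarrow> (base (tail (quiver (blossomed B)) (tau B p)), i)),
      head = (\<lambda>\<alpha>. case \<alpha> of Copy \<beta> i \<Rightarrow> (head (quiver A) \<beta>, i)
                          | Conn p i \<Rightarrow> (base (head (quiver (blossomed B)) (sigma B p)), i + 1))\<rparr>"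

definition repetition_relations :: "('v, 'a, 'k::field) bound_quiver \<Rightarrow>
    ('v, 'a, 'k) blossoming \<Rightarrow> nat \<Rightarrow> ('a repetition_arrow \<times> 'a repetition_arrow) set" where
  "repetition_relations A B k =
     {(Copy \<alpha> i, Copy \<beta> i) | \<alpha> \<beta> i. i \<in> {1..k} \<and> zero_product A \<alpha> \<beta>} \<union>
     {(Copy \<alpha> i, Conn p i) | \<alpha> p i. i \<in> {1..<k} \<and> \<alpha> \<in> arcs (quiver A) \<and> p \<in> {1..defect A} \<and>
        zero_product (blossomed B) (Old_Arrow \<alpha>) (tau B p)} \<union>
     {(Conn p i, Copy \<beta> (i + 1)) | p \<beta> i. i \<in> {1..<k} \<and> \<beta> \<in> arcs (quiver A) \<and> p \<in> {1..defect A} \<and>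
        zero_product (blossomed B) (sigma B p) (Old_Arrow \<beta>)} \<union>
     {(Conn p i, Conn r (i + 1)) | p r i. i \<in> {1..<k} \<and> i + 1 \<in> {1..<k} \<and>
        p \<in> {1..defect A} \<and> r \<in> {1..defect A} \<and>
        zero_product (blossomed B) (sigma B p) (tau B r)}"

definition repetition :: "('v, 'a, 'k::field) bound_quiver \<Rightarrow> ('v, 'a, 'k) blossoming \<Rightarrow> nat \<Rightarrow>
    ('v \<times> nat, 'a repetition_arrow, 'k) bound_quiver" where
  "repetition A B k =
     \<lparr>quiver = repetition_quiver A B k,
      ideal_of = Idl\<^bsub>path_algebra (repetition_quiver A B k)\<^esub>
        ((\<lambda>(\<alpha>, \<beta>). path_elem (tail (repetition_quiver A B k) \<alpha>, [\<alpha>, \<beta>])) `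
           repetition_relations A B k)\<rparr>"


section \<open>AG invariants\<close>

definition AG_perm :: "('v, 'a, 'k::field) bound_quiver \<Rightarrow> ('v, 'a, 'k) blossoming \<Rightarrow> nat \<Rightarrow> nat" where
  "AG_perm A B p = (THE r. r \<in> {1..defect A} \<and>
     (\<exists>xs. maximal (blossomed B) (antipath (blossomed B)) (source_label B r, xs) \<and>
           path_target (quiver (blossomed B)) (source_label B r, xs) = sink_label B p))"

definition AG_delta ::
    "('v, 'a, 'k::field) bound_quiver \<Rightarrow> ('v, 'a, 'k) blossoming \<Rightarrow> nat \<Rightarrow> ('v, 'a) path" where
  "AG_delta A B p = (THE x. x \<in> paths (quiver A) \<and>
     head (quiver (blossomed B)) (sigma B (AG_perm A B p)) = Old (fst x) \<and>
     maximal (blossomed B) (antipath (blossomed B))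
       (source_label B (AG_perm A B p),
        [sigma B (AG_perm A B p)] @ map Old_Arrow (snd x) @ [tau B p]))"

text \<open>\<open>orbit f p\<close> consists of the \<open>(f ^^ n) p\<close> with \<open>n > 0\<close>; it contains \<open>p\<close> since \<open>AG_perm\<close> permutes
  a finite set.\<close>

definition AG_orbits ::
    "('v, 'a, 'k::field) bound_quiver \<Rightarrow> ('v, 'a, 'k) blossoming \<Rightarrow> ('v, 'a) path set set" where
  "AG_orbits A B = (\<lambda>p. AG_delta A B ` orbit (AG_perm A B) p) ` {1..defect A}"

definition AG_number ::
    "('v, 'a, 'k::field) bound_quiver \<Rightarrow> ('v, 'a, 'k) blossoming \<Rightarrow> nat \<Rightarrow> nat \<Rightarrow> nat" where
  "AG_number A B q l =
     card {\<O> \<in> AG_orbits A B. card \<O> = q \<and> (\<Sum>x\<in>\<O>. length (snd x)) = l}"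


section \<open>The Moebius function\<close>

definition moebius :: "nat \<Rightarrow> int" where
  "moebius n = (if squarefree n then (- 1) ^ card (prime_factors n) else 0)"

end

theory Submission
  imports Defs
begin

text \<open>
  The blossoming of \<open>A\<close> has two incoming and two outgoing arrows at every vertex of \<open>A\<close>, and there
  the zero products match the incoming arrows with the outgoing ones, the nonzero products doing so
  in the opposite way (\<open>Z_checkerboard\<close>). Starting from a new source and always continuing by a zero
  product, or always by a nonzero product, therefore gives a uniquely determined \<^emph>\<open>thread\<close>, which
  ends at a new sink. The nonzero thread from \<open>\<sigma>\<^sub>p\<close> ends in \<open>\<tau>\<^sub>p\<close> by the choice of labels, and the zero
  thread that ends in \<open>\<tau>\<^sub>p\<close> starts at \<open>\<sigma>\<close> of \<open>\<Phi> p\<close> and has \<open>\<delta>\<^sub>p\<close> in the middle. Distinct labels have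
  distinct \<open>\<delta>\<close>, so AG-orbits are the orbits of the permutation \<open>\<Phi>\<close> of the labels, weighted by the
  lengths of the \<open>\<delta>\<^sub>p\<close> (\<open>mult_AG_number\<close>).

  In the \<open>k\<close>-fold repetition a connecting arrow with label \<open>p\<close> behaves like \<open>\<tau>\<^sub>p\<close> towards the arrows
  before it and like \<open>\<sigma>\<^sub>p\<close> towards the arrows after it. A thread thus runs through the threads of the
  \<open>k\<close> layers one after the other (\<open>thread_through_layers\<close>). The nonzero threads still lead from \<open>p\<close>
  to \<open>p\<close>, so the labels of the repetition can be identified with those of \<open>A\<close>; the zero thread that
  ends in label \<open>p\<close> starts at \<open>\<Phi>\<^sup>k p\<close>, and its middle part consists of \<open>\<delta>\<close> of \<open>p\<close>, \<open>\<Phi> p\<close>, up to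
  \<open>\<Phi>\<^sup>k\<^sup>-\<^sup>1 p\<close>, separated by \<open>k - 1\<close> connecting arrows. Hence (\<open>AG_number_repetition\<close>) the AG-orbits of
  type \<open>(1, k + m - 1)\<close> of the repetition correspond to the labels \<open>p\<close> with \<open>\<Phi>\<^sup>k p = p\<close> for which the
  lengths of these \<open>\<delta>\<close> add up to \<open>m\<close>.

  Such a \<open>p\<close> lies on a \<open>\<Phi>\<close>-orbit of type \<open>(k / e, m / e)\<close> for a common divisor \<open>e\<close> of \<open>k\<close> and \<open>m\<close>
  (\<open>card_fixed_points_funpow\<close>). With \<open>k = q / c\<close> and \<open>m = l / c\<close>, the sum over \<open>c\<close> in the theorem is the
  one that Moebius inversion over the divisors of \<open>gcd q l\<close> reduces to its term for orbits of type
  \<open>(q, l)\<close>, and there are \<open>q\<close> labels on each of these.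
\<close>


section \<open>Moebius inversion and weighted orbits\<close>

text \<open>Only squarefree divisors contribute. They correspond to the sets of prime factors of
  \<open>n\<close>, and the signed sum over these sets is the expansion of a product of factors
  \<open>1 - 1\<close>.\<close>

lemma sum_moebius_divisors:
  fixes n :: nat
  assumes "n > 0"
  shows "(\<Sum>c | c dvd n. moebius c) = (if n = 1 then 1 else 0)"
proof -
  have fin: "finite {c. c dvd n}" using assms by simp
  have "(\<Sum>c | c dvd n. moebius c) = (\<Sum>c | c dvd n \<and> squarefree c. (- 1) ^ card (prime_factors c))"
    using fin by (intro sum.mono_neutral_cong_right) (auto simp: moebius_def)
  also have "\<dots> = (\<Sum>X\<in>Pow (prime_factors n). (- 1) ^ card X)"
  proof (rule sum.reindex_bij_witness[where i = Prod and j = prime_factors])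
    fix c assume c: "c \<in> {c. c dvd n \<and> squarefree c}"
    hence c0: "c \<noteq> 0" using assms by auto
    show "\<Prod>(prime_factors c) = c"
    proof -
      have "multiplicity p c = 1" if "p \<in> prime_factors c" for p
        using c c0 that by (simp add: squarefree_factorial_semiring' )
      hence "\<Prod>(prime_factors c) = (\<Prod>p\<in>prime_factors c. p ^ multiplicity p c)" by simp
      also have "\<dots> = c" using c0 prod_prime_factors[of c] by simp
      finally show ?thesis .
    qed
    show "prime_factors c \<in> Pow (prime_factors n)"
      using c assms dvd_prime_factors[of n c] by auto
  next
    fix X assume X: "X \<in> Pow (prime_factors n)"
    have finX: "finite X" using X finite_subset by blast
    have prX: "prime p" if "p \<in> X" for p using X that by auto
    show eq: "prime_factors (\<Prod>X) = X"
    proof -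
      have "0 \<notin> X" using prX by fastforce
      hence "prime_factors (\<Prod>X) = (\<Union>p\<in>X. prime_factors p)"
        using prime_factors_prod[of X "\<lambda>x. x"] finX by simp
      also have "\<dots> = (\<Union>p\<in>X. {p})"
        using prX by (intro SUP_cong refl) (simp add: prime_factorization_prime)
      finally show ?thesis by simp
    qed
    have dvd: "\<Prod>X dvd n"
    proof -
      have "\<Prod>X dvd (\<Prod>p\<in>prime_factors n. p)"
        using X by (intro prod_dvd_prod_subset) auto
      also have "\<dots> dvd (\<Prod>p\<in>prime_factors n. p ^ multiplicity p n)"
        using assms by (intro prod_dvd_prod dvd_power_same) (auto simp: prime_factors_multiplicity intro: dvd_power)
      also have "\<dots> = n" using assms prod_prime_factors[of n] by simp
      finally show ?thesis by (simp)
    qed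
    moreover have "squarefree (\<Prod>X)"
      using prX by (intro squarefree_prod_coprime) (auto intro: primes_coprime squarefree_prime)
    ultimately show "\<Prod>X \<in> {c. c dvd n \<and> squarefree c}" by simp
  qed (auto)
  also have "\<dots> = (\<Prod>p\<in>prime_factors n. 1 - 1)"
    by (subst prod_diff_conv_sum) auto
  also have "\<dots> = (if n = 1 then 1 else 0)"
    using assms by (auto simp: card_gt_0_iff prime_factorization_empty_iff)
  finally show ?thesis .
qed

text \<open>Collecting the terms with the same product \<open>n = c * e\<close> leaves \<open>g
  n\<close> times the sum of \<open>moebius\<close> over the divisors of \<open>n\<close>, which
  vanishes for \<open>n > 1\<close>.\<close>

lemma moebius_inversion_divisors:
  fixes g :: "nat \<Rightarrow> real" and d :: nat
  assumes d: "d > 0"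
  shows "(\<Sum>c | c dvd d. real_of_int (moebius c) * (\<Sum>e | e dvd d div c. g (c * e))) = g 1"
proof -
  have fin: "finite {c. c dvd m}" if "m dvd d" for m :: nat using d that
    by (intro finite_divisors_nat) (auto intro!: Nat.gr0I)
  have "(\<Sum>c | c dvd d. real_of_int (moebius c) * (\<Sum>e | e dvd d div c. g (c * e)))
     = (\<Sum>(c, e) \<in> (SIGMA c:{c. c dvd d}. {e. e dvd d div c}). real_of_int (moebius c) * g (c * e))"
    using fin by (subst sum.Sigma[symmetric]) (auto simp: sum_distrib_left)
  also have "\<dots> = (\<Sum>(n, c) \<in> (SIGMA n:{n. n dvd d}. {c. c dvd n}). real_of_int (moebius c) * g n)"
  proof (rule sum.reindex_bij_witness[where i = "\<lambda>(n, c). (c, n div c)" and j = "\<lambda>(c, e). (c * e, c)"], goal_cases)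
    case (1 a)
    then show ?case using d by (auto simp: dvd_div_eq_mult intro!: nonzero_mult_div_cancel_left)
  next
    case (2 a)
    then show ?case using d
      by (auto elim!: dvdE simp: ac_simps)
  next
    case (3 b)
    then show ?case by auto
  next
    case (4 b)
    then show ?case using d by (auto elim!: dvdE)
  next
    case (5 a)
    then show ?case by auto
  qed
  also have "\<dots> = (\<Sum>n | n dvd d. g n * real_of_int (\<Sum>c | c dvd n. moebius c))"
    using fin by (subst sum.Sigma[symmetric]) (auto simp: sum_distrib_left mult_ac)
  also have "\<dots> = (\<Sum>n | n dvd d. if n = 1 then g n else 0)"
    using d by (intro sum.cong) (auto simp: sum_moebius_divisors dvd_pos_nat simp del: of_int_sum)
  also have "\<dots> = g 1" using fin[of d] by (simp)
  finally show ?thesis .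
qed

text \<open>Outside \<open>P\<close> the map \<open>f\<close> is arbitrary. Within
  \<open>P\<close> it has the same orbits as its extension by the identity, which is a
  permutation.\<close>

lemma self_in_orbit_bij_betw:
  assumes "finite P" "bij_betw f P P" "x \<in> P"
  shows "x \<in> orbit f x" "orbit f x \<subseteq> P"
proof -
  define g where "g = (\<lambda>y. if y \<in> P then f y else y)"
  have "bij_betw g P P" using assms(2) by (subst bij_betw_cong[of _ _ f]) (auto simp: g_def)
  hence g: "g permutes P" by (intro bij_imp_permutes) (auto simp: g_def)
  have "orbit f x = orbit g x"
    using assms by (intro orbit_cong0[where A=P]) (auto simp: g_def bij_betw_def)
  thus "x \<in> orbit f x"
    using permutation_self_in_orbit[of g x] g assms(1) by (auto simp: permutation_permutes)
  show "orbit f x \<subseteq> P" using assms \<open>orbit f x = orbit g x\<close> permutes_orbit_subset[OF g] by simp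
qed

lemma funpow_card_orbit:
  assumes "x \<in> orbit f x"
  shows "orbit f x = (\<lambda>n. (f ^^ n) x) ` {0..<card (orbit f x)}"
    and "inj_on (\<lambda>n. (f ^^ n) x) {0..<card (orbit f x)}"
    and "(f ^^ card (orbit f x)) x = x"
    and "card (orbit f x) > 0"
proof -
  have 1: "orbit f x = (\<lambda>n. (f ^^ n) x) ` {0..<funpow_dist1 f x x}"
    by (rule orbit_conv_funpow_dist1[OF assms])
  have 2: "inj_on (\<lambda>n. (f ^^ n) x) {0..<funpow_dist1 f x x}"
    by (rule inj_on_funpow_dist1[OF assms])
  have c: "card (orbit f x) = funpow_dist1 f x x"
    by (subst 1, subst card_image[OF 2]) simp
  show "orbit f x = (\<lambda>n. (f ^^ n) x) ` {0..<card (orbit f x)}"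
    "inj_on (\<lambda>n. (f ^^ n) x) {0..<card (orbit f x)}"
    "(f ^^ card (orbit f x)) x = x" "card (orbit f x) > 0"
    unfolding c by (rule 1, rule 2, rule funpow_dist1_prop[OF assms], simp)
qed

lemma funpow_fixed_iff_card_orbit_dvd:
  assumes "x \<in> orbit f x"
  shows "(f ^^ m) x = x \<longleftrightarrow> card (orbit f x) dvd m"
proof -
  let ?n = "card (orbit f x)"
  note o = funpow_card_orbit[OF assms]
  have "(f ^^ m) x = (f ^^ (m mod ?n)) x" using funpow_mod_eq[OF o(3)] by simp
  also have "\<dots> = x \<longleftrightarrow> m mod ?n = 0"
    using inj_onD[OF o(2), of "m mod ?n" 0] o(4) by auto
  finally show ?thesis by (simp add: dvd_eq_mod_eq_0)
qed

text \<open>These steps go \<open>e\<close> times round the orbit.\<close>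

lemma sum_funpow_multiple_card_orbit:
  fixes w :: "'a \<Rightarrow> nat"
  assumes "x \<in> orbit f x"
  shows "(\<Sum>i<card (orbit f x) * e. w ((f ^^ i) x)) = e * sum w (orbit f x)"
proof (induction e)
  case (Suc e)
  let ?n = "card (orbit f x)"
  note o = funpow_card_orbit[OF assms]
  have fixd: "(f ^^ (?n * e)) x = x"
    using funpow_fixed_iff_card_orbit_dvd[OF assms] by simp
  have split: "(\<Sum>i<a + b. h i) = (\<Sum>i<a. h i) + (\<Sum>i<b. h (i + a))" for h :: "nat \<Rightarrow> nat" and a b
    by (induction b) (auto simp: add_ac)
  have "(\<Sum>i<?n * Suc e. w ((f ^^ i) x)) =
     (\<Sum>i<?n * e. w ((f ^^ i) x)) + (\<Sum>i<?n. w ((f ^^ (i + ?n * e)) x))"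
    using split[of "\<lambda>i. w ((f ^^ i) x)" "?n * e" ?n] by (simp add: add.commute)
  also have "(\<Sum>i<?n. w ((f ^^ (i + ?n * e)) x)) = (\<Sum>i<?n. w ((f ^^ i) x))"
    by (simp add: funpow_add fixd)
  also have "\<dots> = sum w (orbit f x)"
    by (subst (2) o(1), subst sum.reindex[OF o(2)]) (simp add: lessThan_atLeast0)
  finally show ?case using Suc by simp
qed simp

text \<open>A fixed point of \<open>f ^^ m\<close> lies on an orbit of length \<open>m / e\<close>
  for some \<open>e\<close>; the first \<open>m\<close> iterates go round it \<open>e\<close>
  times, so its weight is \<open>L / e\<close>. The length determines \<open>e\<close>, so the
  summands count disjoint sets.\<close>

lemma card_fixed_points_funpow:
  fixes w :: "'a \<Rightarrow> nat"
  assumes P: "finite P" "bij_betw f P P" and m: "m > 0"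
  shows "card {p \<in> P. (f ^^ m) p = p \<and> (\<Sum>i<m. w ((f ^^ i) p)) = L} =
    (\<Sum>e | e dvd gcd m L. card {p \<in> P. card (orbit f p) = m div e \<and> sum w (orbit f p) = L div e})"
proof -
  let ?S = "\<lambda>e. {p \<in> P. card (orbit f p) = m div e \<and> sum w (orbit f p) = L div e}"
  have "{p \<in> P. (f ^^ m) p = p \<and> (\<Sum>i<m. w ((f ^^ i) p)) = L} = (\<Union>e\<in>{e. e dvd gcd m L}. ?S e)"
  proof (intro equalityI subsetI)
    fix p assume p: "p \<in> {p \<in> P. (f ^^ m) p = p \<and> (\<Sum>i<m. w ((f ^^ i) p)) = L}"
    hence o: "p \<in> orbit f p" using self_in_orbit_bij_betw[OF P] by auto
    from p obtain e where e: "m = card (orbit f p) * e"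
      using funpow_fixed_iff_card_orbit_dvd[OF o] by (auto elim: dvdE)
    hence "L = e * sum w (orbit f p)" using p sum_funpow_multiple_card_orbit[OF o, of w e] by auto
    moreover have "e > 0" using e m by (cases e) auto
    ultimately have "e dvd gcd m L" "p \<in> ?S e" using e p by auto
    thus "p \<in> (\<Union>e\<in>{e. e dvd gcd m L}. ?S e)" by blast
  next
    fix p assume "p \<in> (\<Union>e\<in>{e. e dvd gcd m L}. ?S e)"
    then obtain e where e: "e dvd m" "e dvd L" "p \<in> P" "card (orbit f p) = m div e"
      "sum w (orbit f p) = L div e" by auto
    hence o: "p \<in> orbit f p" using self_in_orbit_bij_betw[OF P] by auto
    have me: "m = card (orbit f p) * e" "L = e * sum w (orbit f p)" using e by auto
    hence "(f ^^ m) p = p" using funpow_fixed_iff_card_orbit_dvd[OF o] by simp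
    moreover have "(\<Sum>i<m. w ((f ^^ i) p)) = L"
      using sum_funpow_multiple_card_orbit[OF o, of w e] me by simp
    ultimately show "p \<in> {p \<in> P. (f ^^ m) p = p \<and> (\<Sum>i<m. w ((f ^^ i) p)) = L}" using e by simp
  qed
  moreover have "card (\<Union>e\<in>{e. e dvd gcd m L}. ?S e) = (\<Sum>e\<in>{e. e dvd gcd m L}. card (?S e))"
  proof (rule card_UN_disjoint)
    show "\<forall>i\<in>{e. e dvd gcd m L}. \<forall>j\<in>{e. e dvd gcd m L}. i \<noteq> j \<longrightarrow> ?S i \<inter> ?S j = {}"
    proof (intro ballI impI)
      fix i j assume ij: "i \<in> {e. e dvd gcd m L}" "j \<in> {e. e dvd gcd m L}" "i \<noteq> j"
      hence "m div i * i = m" "m div j * j = m" by auto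
      hence "m div i \<noteq> m div j" using m ij(3) by (metis mult_cancel1 mult_0 neq0_conv)
      thus "?S i \<inter> ?S j = {}" by auto
    qed
  qed (use P m in auto)
  ultimately show ?thesis by simp
qed

text \<open>Orbits are disjoint, and each orbit that is counted on the right contributes its
  \<open>q\<close> points.\<close>

lemma card_points_in_orbits_of_type:
  fixes w :: "'a \<Rightarrow> nat"
  assumes P: "finite P" "bij_betw f P P"
  shows "card {p \<in> P. card (orbit f p) = q \<and> sum w (orbit f p) = l} =
    q * card {X \<in> orbit f ` P. card X = q \<and> sum w X = l}"
proof -
  let ?C = "{X \<in> orbit f ` P. card X = q \<and> sum w X = l}"
  note self = self_in_orbit_bij_betw[OF P]
  have eq: "orbit f y = orbit f x" if "y \<in> orbit f x" "x \<in> P" for x y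
  proof (rule orbit_cyclic_eq3[OF _ that(1)])
    show "cyclic_on f (orbit f x)" using self[OF that(2)] by (auto simp: cyclic_on_def)
  qed
  have U: "\<Union>?C = {p \<in> P. card (orbit f p) = q \<and> sum w (orbit f p) = l}"
  proof (intro equalityI subsetI)
    fix p assume "p \<in> \<Union>?C"
    then obtain x where x: "x \<in> P" "p \<in> orbit f x" "card (orbit f x) = q" "sum w (orbit f x) = l"
      by auto
    thus "p \<in> {p \<in> P. card (orbit f p) = q \<and> sum w (orbit f p) = l}"
      using eq[OF x(2,1)] self(2)[OF x(1)] by auto
  next
    fix p assume "p \<in> {p \<in> P. card (orbit f p) = q \<and> sum w (orbit f p) = l}"
    thus "p \<in> \<Union>?C" using self(1)[of p] by blast
  qed
  have "q * card ?C = card (\<Union>?C)"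
  proof (rule card_partition)
    fix X Y assume "X \<in> ?C" "Y \<in> ?C" "X \<noteq> Y"
    thus "X \<inter> Y = {}" using eq by blast
  qed (use P U in auto)
  thus ?thesis using U by simp
qed


section \<open>Chains of a relation and products of arrows\<close>

lemma relpowp_conversep: fixes R :: "'a \<Rightarrow> 'a \<Rightarrow> bool" shows "(R\<inverse>\<inverse> ^^ m) y x \<longleftrightarrow> (R ^^ m) x y"
proof (induction m arbitrary: x y)
  case (Suc m)
  show ?case unfolding relpowp_Suc_right[of m "R\<inverse>\<inverse>"] relpowp_Suc_left[of m R] by (auto simp: OO_def Suc)
qed auto

text \<open>A chain from \<open>s\<close> has no choice in any step, and it stops where it cannot
  be continued.\<close>

lemma relpowp_terminal_unique:
  assumes "right_unique R" "(R ^^ m) s t" "(R ^^ n) s u" "\<nexists>y. R t y" "\<nexists>y. R u y"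
  shows "m = n \<and> t = u"
  using assms(2-)
proof (induction m arbitrary: s n)
  case 0
  hence "s = t" by simp
  show ?case
  proof (cases n)
    case (Suc n')
    with 0 obtain y where "R s y" by (metis relpowp_Suc_D2)
    thus ?thesis using 0 \<open>s = t\<close> by blast
  qed (use 0 in auto)
next
  case (Suc m)
  from Suc.prems(1) obtain v where v: "R s v" "(R ^^ m) v t" by (rule relpowp_Suc_E2)
  obtain n' where n: "n = Suc n'"
    using v(1) Suc.prems(2,4) by (cases n) auto
  with Suc.prems(2) obtain w where w: "R s w" "(R ^^ n') w u" by (metis relpowp_Suc_D2)
  have "w = v" using w(1) v(1) assms(1) by (metis right_uniqueD)
  hence "m = n' \<and> t = u" using Suc.IH[OF v(2) _ Suc.prems(3,4)] w(2) by simp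
  thus ?case using n by simp
qed

lemma relpowp_initial_unique:
  assumes "left_unique R" "(R ^^ m) s u" "(R ^^ n) t u" "\<nexists>y. R y s" "\<nexists>y. R y t"
  shows "m = n \<and> s = t"
proof -
  have "(R\<inverse>\<inverse> ^^ m) u s" "(R\<inverse>\<inverse> ^^ n) u t"
    using assms(2,3) by (simp_all add: relpowp_conversep)
  moreover have "right_unique R\<inverse>\<inverse>" using assms(1) by (simp add: left_unique_def right_unique_def)
  ultimately show ?thesis
    using relpowp_terminal_unique[of "R\<inverse>\<inverse>" m u s n t] assms(4,5) by simp
qed

text \<open>Otherwise one can go back from \<open>t\<close> for ever. The elements met on the way
  are distinct, since a repetition would give chains of different lengths from one element to the
  dead end \<open>t\<close>; but \<open>E\<close> is finite.\<close>

lemma relpowp_reaches_initial: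
  assumes "finite E" "right_unique R" "t \<in> E" "\<nexists>y. R t y"
    and pred: "\<And>y. y \<in> E \<Longrightarrow> y \<notin> S \<Longrightarrow> \<exists>x\<in>E. R x y"
  shows "\<exists>s\<in>S \<inter> E. \<exists>m. (R ^^ m) s t"
proof (rule ccontr)
  assume no: "\<not> ?thesis"
  define b where "b = (\<lambda>y. SOME x. x \<in> E \<and> R x y)"
  have b: "b y \<in> E \<and> R (b y) y" if "y \<in> E" "y \<notin> S" for y
    unfolding b_def by (rule someI_ex) (use pred[OF that] in blast)
  have walk: "(b ^^ m) t \<in> E \<and> (R ^^ m) ((b ^^ m) t) t" for m
  proof (induction m)
    case (Suc m)
    hence "(b ^^ m) t \<notin> S" using no by blast
    with b[of "(b ^^ m) t"] Suc have "b ((b ^^ m) t) \<in> E" "R (b ((b ^^ m) t)) ((b ^^ m) t)" by blast+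
    thus ?case using relpowp_Suc_I2[of R _ "(b ^^ m) t" m t] Suc by (simp only: funpow.simps o_apply)
  qed (use assms in auto)
  have "inj (\<lambda>m. (b ^^ m) t)"
  proof (rule injI)
    fix m n assume "(b ^^ m) t = (b ^^ n) t"
    hence "(R ^^ n) ((b ^^ m) t) t" using walk[of n] by simp
    thus "m = n" using relpowp_terminal_unique[OF assms(2) _ _ assms(4,4)] walk[of m] by blast
  qed
  hence "infinite (range (\<lambda>m. (b ^^ m) t))" by (rule range_inj_infinite)
  moreover have "range (\<lambda>m. (b ^^ m) t) \<subseteq> E" using walk by auto
  ultimately show False using assms(1) finite_subset by blast
qed

lemma successively_imp_relpowp:
  "xs \<noteq> [] \<Longrightarrow> successively R xs \<Longrightarrow> (R ^^ (length xs - 1)) (hd xs) (last xs)"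
proof (induction R xs rule: successively.induct)
  case (3 P x y xs)
  hence "P x y" "(P ^^ length xs) y (last (y # xs))" by simp_all
  hence "(P ^^ Suc (length xs)) x (last (y # xs))" by (rule relpowp_Suc_I2)
  thus ?case by simp
qed auto

lemma relpowp_imp_successively:
  assumes "(R ^^ m) x y"
  obtains xs where "length xs = Suc m" "successively R xs" "hd xs = x" "last xs = y"
proof -
  from assms have "\<exists>xs. length xs = Suc m \<and> successively R xs \<and> hd xs = x \<and> last xs = y"
  proof (induction m arbitrary: x)
    case 0
    thus ?case by (intro exI[of _ "[x]"]) auto
  next
    case (Suc m)
    from Suc.prems obtain z where "R x z" "(R ^^ m) z y" by (rule relpowp_Suc_E2)
    with Suc.IH obtain xs where "length xs = Suc m" "successively R xs" "hd xs = z" "last xs = y" by blast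
    thus ?case using \<open>R x z\<close>
      by (intro exI[of _ "x # xs"]) (auto simp: successively_Cons)
  qed
  thus ?thesis using that by blast
qed

lemma successively_unique:
  assumes "right_unique R"
  shows "successively R (x # xs) \<Longrightarrow> successively R (x # ys) \<Longrightarrow> length xs = length ys \<Longrightarrow> xs = ys"
proof (induction xs ys arbitrary: x rule: list_induct2')
  case (4 a xs b ys)
  thus ?case using right_uniqueD[OF assms, of x a b] by (auto simp: successively_Cons)
qed auto

lemma successivelyI_split:
  "(\<And>ys a b zs. xs = ys @ [a, b] @ zs \<Longrightarrow> R a b) \<Longrightarrow> successively R xs"
proof (induction xs)
  case (Cons x xs)
  have "successively R xs"
  proof (rule Cons.IH)
    fix ys a b zs assume "xs = ys @ [a, b] @ zs"
    thus "R a b" using Cons.prems[of "x # ys" a b zs] by simp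
  qed
  moreover have "R x y" if "xs = y # zs" for y zs
    using Cons.prems[of "[]" x y zs] that by simp
  ultimately show ?case by (cases xs) auto
qed simp

lemma nonempty_path_iff:
  assumes "xs \<noteq> []"
  shows "(u, xs) \<in> paths Q \<longleftrightarrow> u \<in> verts Q \<and> set xs \<subseteq> arcs Q \<and> tail Q (hd xs) = u \<and>
     successively (\<lambda>a b. head Q a = tail Q b) xs"
proof -
  have "pre_digraph.cas Q u xs (path_target Q (u, xs)) \<longleftrightarrow> tail Q (hd xs) = u \<and>
     successively (\<lambda>a b. head Q a = tail Q b) xs"
    using assms
  proof (induction xs arbitrary: u)
    case (Cons x xs)
    show ?case
    proof (cases "xs = []")
      case False
      show ?thesis
        unfolding path_target_simps pre_digraph.cas.simps successively_Cons list.sel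
        using Cons.IH[of "head Q x", OF False] False by metis
    qed (simp add: pre_digraph.cas.simps)
  qed simp
  thus ?thesis by (auto simp: paths_iff)
qed

lemma path_target_last: "xs \<noteq> [] \<Longrightarrow> path_target Q (u, xs) = head Q (last xs)"
  by (induction xs arbitrary: u) auto

lemma paths_appendD:
  assumes "(u, xs @ ys) \<in> paths Q" "fin_digraph Q"
  shows "(u, xs) \<in> paths Q" "(path_target Q (u, xs), ys) \<in> paths Q"
proof -
  show *: "(u, xs) \<in> paths Q" using assms by (auto simp: paths_iff cas_append)
  show "(path_target Q (u, xs), ys) \<in> paths Q"
    using assms paths_target_in_verts[OF assms(2) *]
    by (auto simp: paths_iff cas_append path_target_append)
qed

lemma path_elem_append:
  "path_mult Q (path_elem (u, xs)) (path_elem (path_target Q (u, xs), ys)) = path_elem (u, xs @ ys)"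
  by (simp add: path_elem_def path_mult_single)

lemma antipath_iff:
  "antipath A (u, xs) \<longleftrightarrow> u \<in> verts (quiver A) \<and> xs \<noteq> [] \<and> set xs \<subseteq> arcs (quiver A) \<and>
     tail (quiver A) (hd xs) = u \<and> successively (zero_product A) xs"
proof -
  have "successively (\<lambda>a b. head (quiver A) a = tail (quiver A) b) xs" if "successively (zero_product A) xs"
    using that by (rule successively_mono) (simp add: zero_product_def composable_def)
  thus ?thesis
    by (cases "xs = []") (simp_all add: antipath_def nonempty_path_iff, blast)
qed

text \<open>If a product of two consecutive arrows were in the ideal, then so would be the whole
  path, because an ideal absorbs multiplication by the parts before and after it.\<close>

lemma successively_nonzero_product:
  assumes "locally_gentle A" "nonzero_path A (u, xs)"
  shows "successively (nonzero_product A) xs"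
proof (rule successivelyI_split)
  fix ys a b zs assume xs: "xs = ys @ [a, b] @ zs"
  let ?Q = "quiver A"
  have Q: "fin_digraph ?Q" using assms by (simp add: locally_gentle_def)
  interpret ring "path_algebra ?Q :: (('a, 'b) path \<Rightarrow>\<^sub>0 'c) ring" by (rule path_algebra_ring[OF Q])
  obtain R where R: "R \<subseteq> {x \<in> paths ?Q. length (snd x) = 2}"
    "ideal_of A = Idl\<^bsub>path_algebra ?Q\<^esub> (path_elem ` R)"
    using assms(1) by (auto simp: locally_gentle_def)
  have car: "path_elem x \<in> carrier (path_algebra ?Q :: (('a, 'b) path \<Rightarrow>\<^sub>0 'c) ring)" if "x \<in> paths ?Q" for x
    using that by (auto simp: path_algebra_def path_elem_def)
  have ideal: "ideal (ideal_of A) (path_algebra ?Q)"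
    unfolding R(2) using R(1) car by (intro genideal_ideal) auto
  have p: "(u, xs) \<in> paths ?Q" and n: "path_elem (u, xs) \<notin> ideal_of A"
    using assms(2) by (auto simp: nonzero_path_def)
  define v where "v = path_target ?Q (u, ys)"
  define w where "w = path_target ?Q (v, [a, b])"
  note p1 = paths_appendD[OF p[unfolded xs] Q, folded v_def]
  note p2 = paths_appendD[OF p1(2) Q, folded w_def]
  have ab: "composable A a b" "tail ?Q a = v"
    using p2(1) by (auto simp: nonempty_path_iff composable_def)
  show "nonzero_product A a b"
  proof (rule ccontr)
    assume "\<not> nonzero_product A a b"
    hence "path_elem (v, [a, b]) \<in> ideal_of A"
      using ab by (auto simp: nonzero_product_def)
    hence "path_mult ?Q (path_elem (v, [a, b])) (path_elem (w, zs)) \<in> ideal_of A"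
      using ideal.I_r_closed[OF ideal _ car[OF p2(2)]] by (simp add: path_algebra_def)
    hence "path_elem (v, [a, b] @ zs) \<in> ideal_of A"
      unfolding w_def path_elem_append .
    hence "path_mult ?Q (path_elem (u, ys)) (path_elem (v, [a, b] @ zs)) \<in> ideal_of A"
      using ideal.I_l_closed[OF ideal _ car[OF p1(1)]] by (simp add: path_algebra_def)
    hence "path_elem (u, xs) \<in> ideal_of A"
      unfolding v_def path_elem_append xs .
    thus False using n by simp
  qed
qed

text \<open>A path in the ideal contains a generator, and a path of length 2 contains one only if
  it is one.\<close>

lemma zero_product_genideal:
  fixes Q :: "('v, 'a) pre_digraph" and R :: "('a \<times> 'a) set"
  assumes "fin_digraph Q"
    and R: "\<And>\<alpha> \<beta>. (\<alpha>, \<beta>) \<in> R \<Longrightarrow> \<alpha> \<in> arcs Q \<and> \<beta> \<in> arcs Q \<and> head Q \<alpha> = tail Q \<beta>"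
  shows "zero_product \<lparr>quiver = Q, ideal_of = Idl\<^bsub>path_algebra Q\<^esub>
      ((\<lambda>(\<alpha>, \<beta>). path_elem (tail Q \<alpha>, [\<alpha>, \<beta>]) :: ('v, 'a) path \<Rightarrow>\<^sub>0 'k::field) ` R)\<rparr> \<alpha> \<beta> \<longleftrightarrow> (\<alpha>, \<beta>) \<in> R"
    (is "zero_product ?A \<alpha> \<beta> \<longleftrightarrow> _")
proof -
  interpret fin_digraph Q by fact
  interpret ring "path_algebra Q :: (('v, 'a) path \<Rightarrow>\<^sub>0 'k) ring" by (rule path_algebra_ring) fact
  define R' where "R' = (\<lambda>(\<alpha>, \<beta>). (tail Q \<alpha>, [\<alpha>, \<beta>])) ` R"
  have R': "R' \<subseteq> {x \<in> paths Q. length (snd x) = 2}"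
    using R by (force simp: R'_def nonempty_path_iff)
  have I: "ideal_of ?A = Idl\<^bsub>path_algebra Q\<^esub> (path_elem ` R')"
    by (simp add: R'_def image_image case_prod_unfold)
  have car: "path_elem ` R' \<subseteq> carrier (path_algebra Q :: (('v, 'a) path \<Rightarrow>\<^sub>0 'k) ring)"
    using R' by (auto simp: path_algebra_def path_elem_def)
  show ?thesis
  proof
    assume "(\<alpha>, \<beta>) \<in> R"
    moreover from this have "path_elem (tail Q \<alpha>, [\<alpha>, \<beta>]) \<in> path_elem ` R'"
      by (force simp: R'_def)
    ultimately show "zero_product ?A \<alpha> \<beta>"
      using R[of \<alpha> \<beta>] genideal_self[OF car] unfolding zero_product_def composable_def I by auto
  next
    assume "zero_product ?A \<alpha> \<beta>"
    hence "(path_elem (tail Q \<alpha>, [\<alpha>, \<beta>]) :: ('v, 'a) path \<Rightarrow>\<^sub>0 'k) \<in> Idl\<^bsub>path_algebra Q\<^esub> (path_elem ` R')"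
      unfolding zero_product_def I by simp
    then obtain us r vs where r: "[\<alpha>, \<beta>] = us @ snd r @ vs" "r \<in> R'"
      using path_elem_in_Idl[OF assms(1) R'] by (metis snd_conv)
    then obtain \<gamma> \<delta> where gd: "(\<gamma>, \<delta>) \<in> R" "snd r = [\<gamma>, \<delta>]" by (auto simp: R'_def)
    with r have "us = [] \<and> vs = []" using arg_cong[OF r(1), of length] by (cases us) auto
    with r gd show "(\<alpha>, \<beta>) \<in> R" by auto
  qed
qed


section \<open>Threads in a blossoming\<close>

lemma successively_subset:
  assumes "xs \<noteq> []" "hd xs \<in> S" "successively R xs" "\<And>x y. R x y \<Longrightarrow> y \<in> S"
  shows "set xs \<subseteq> S"
  using assms(1-3)
proof (induction xs)
  case (Cons x xs)
  thus ?case using assms(4) by (cases "xs = []") (auto simp: successively_Cons)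
qed simp

lemma successively_interior:
  assumes "successively R (a # ys @ [b])" "y \<in> set ys"
  shows "\<exists>x z. R x y \<and> R y z"
proof -
  obtain us vs where ys: "ys = us @ y # vs" using assms(2) by (auto simp: in_set_conv_decomp)
  have "successively R ((a # us) @ [y] @ (vs @ [b]))" using assms(1) ys by simp
  hence "R (last (a # us)) y" "R y (hd (vs @ [b]))"
    unfolding successively_append_iff by auto
  thus ?thesis by blast
qed

text \<open>The proof takes place among the arrows of the blossoming, related by their zero
  products \<open>Z\<close> and their nonzero products \<open>N\<close>. A thread is a chain of
  one of these relations, given by a power of the relation, from an arrow \<open>\<sigma>\<close>
  to an arrow \<open>\<tau>\<close>. Isolated vertices are excluded because at such a vertex
  \<open>v\<close> two different labels would share the trivial path \<open>(v, [])\<close> as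
  their \<open>\<delta>\<close>.\<close>

locale blossomed_quiver =
  fixes A :: "('v, 'a, 'k::field) bound_quiver" and B :: "('v, 'a, 'k) blossoming"
  assumes fin: "fin_digraph (quiver A)"
    and labelled: "labelled_blossoming A B"
    and incident: "\<And>v. v \<in> verts (quiver A) \<Longrightarrow>
      \<exists>\<alpha>\<in>arcs (quiver A). tail (quiver A) \<alpha> = v \<or> head (quiver A) \<alpha> = v"
begin

abbreviation "G \<equiv> quiver (blossomed B)"
abbreviation "Z \<equiv> zero_product (blossomed B)"
abbreviation "N \<equiv> nonzero_product (blossomed B)"
abbreviation "labels \<equiv> {1..defect A}"

lemma locally_gentle_blossomed: "locally_gentle (blossomed B)"
  and G_eq: "G = blossom_quiver (quiver A)"
  and Z_Old_iff: "composable A \<alpha> \<beta> \<Longrightarrow> Z (Old_Arrow \<alpha>) (Old_Arrow \<beta>) \<longleftrightarrow> zero_product A \<alpha> \<beta>"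
  using labelled by (auto simp: labelled_blossoming_def is_blossoming_def)

lemma fin_G: "fin_digraph G"
  using locally_gentle_blossomed by (simp add: locally_gentle_def)

lemma tail_G [simp]:
  "tail G (Old_Arrow \<alpha>) = Old (tail (quiver A) \<alpha>)"
  "tail G (New_In v i) = New_Source v i"
  "tail G (New_Out v i) = Old v"
  and head_G [simp]:
  "head G (Old_Arrow \<alpha>) = Old (head (quiver A) \<alpha>)"
  "head G (New_In v i) = Old v"
  "head G (New_Out v i) = New_Sink v i"
  by (simp_all add: G_eq blossom_quiver_def)

lemma arcs_G [simp]:
  "Old_Arrow \<alpha> \<in> arcs G \<longleftrightarrow> \<alpha> \<in> arcs (quiver A)"
  "New_In v i \<in> arcs G \<longleftrightarrow> v \<in> verts (quiver A) \<and> i < 2 - in_degree (quiver A) v"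
  "New_Out v i \<in> arcs G \<longleftrightarrow> v \<in> verts (quiver A) \<and> i < 2 - out_degree (quiver A) v"
  by (auto simp: G_eq blossom_quiver_def)

lemma Old_in_verts_G [simp]: "Old v \<in> verts G \<longleftrightarrow> v \<in> verts (quiver A)"
  by (auto simp: G_eq blossom_quiver_def blossom_sources_def blossom_sinks_def)

lemma composable_if_Z: "Z x y \<Longrightarrow> composable (blossomed B) x y"
  and composable_if_N: "N x y \<Longrightarrow> composable (blossomed B) x y"
  by (auto simp: zero_product_def nonzero_product_def)

lemma N_iff_not_Z: "composable (blossomed B) x y \<Longrightarrow> N x y \<longleftrightarrow> \<not> Z x y"
  by (auto simp: zero_product_def nonzero_product_def)

lemma bi_unique_Z: "bi_unique Z" and bi_unique_N: "bi_unique N"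
proof -
  have "\<And>\<alpha>. \<alpha> \<in> arcs G \<Longrightarrow> (\<exists>\<^sub>\<le>\<^sub>1\<beta>. Z \<beta> \<alpha>) \<and> (\<exists>\<^sub>\<le>\<^sub>1\<beta>. N \<beta> \<alpha>) \<and> (\<exists>\<^sub>\<le>\<^sub>1\<beta>. Z \<alpha> \<beta>) \<and> (\<exists>\<^sub>\<le>\<^sub>1\<beta>. N \<alpha> \<beta>)"
    using locally_gentle_blossomed by (simp add: locally_gentle_def)
  thus "bi_unique Z" "bi_unique N"
    unfolding bi_unique_def Uniq_def
    using composable_if_Z composable_if_N unfolding composable_def by meson+
qed

lemma card_in_arcs_G:
  assumes "v \<in> verts (quiver A)"
  shows "card (in_arcs G (Old v)) = 2"
proof -
  interpret GG: fin_digraph G by (rule fin_G)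
  interpret QQ: fin_digraph "quiver A" by (rule fin)
  have eq: "in_arcs G (Old v) = Old_Arrow ` in_arcs (quiver A) v \<union>
      New_In v ` {..<2 - in_degree (quiver A) v}" (is "_ = ?X \<union> ?Y")
  proof (intro equalityI subsetI)
    fix x assume "x \<in> in_arcs G (Old v)"
    thus "x \<in> ?X \<union> ?Y" by (cases x) auto
  qed (use assms in auto)
  have X: "card ?X = in_degree (quiver A) v"
    by (simp add: card_image inj_on_def in_degree_def)
  have Y: "card ?Y = 2 - in_degree (quiver A) v"
    by (simp add: card_image inj_on_def)
  have "card (in_arcs G (Old v)) = in_degree (quiver A) v + (2 - in_degree (quiver A) v)"
    unfolding eq by (subst card_Un_disjoint) (auto simp: X Y)
  moreover have "card (in_arcs G (Old v)) \<le> 2"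
    using locally_gentle_blossomed assms by (auto simp: locally_gentle_def in_degree_def)
  ultimately show ?thesis by linarith
qed

lemma card_out_arcs_G:
  assumes "v \<in> verts (quiver A)"
  shows "card (out_arcs G (Old v)) = 2"
proof -
  interpret GG: fin_digraph G by (rule fin_G)
  interpret QQ: fin_digraph "quiver A" by (rule fin)
  have eq: "out_arcs G (Old v) = Old_Arrow ` out_arcs (quiver A) v \<union>
      New_Out v ` {..<2 - out_degree (quiver A) v}" (is "_ = ?X \<union> ?Y")
  proof (intro equalityI subsetI)
    fix x assume "x \<in> out_arcs G (Old v)"
    thus "x \<in> ?X \<union> ?Y" by (cases x) auto
  qed (use assms in auto)
  have X: "card ?X = out_degree (quiver A) v"
    by (simp add: card_image inj_on_def out_degree_def)
  have Y: "card ?Y = 2 - out_degree (quiver A) v"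
    by (simp add: card_image inj_on_def)
  have "card (out_arcs G (Old v)) = out_degree (quiver A) v + (2 - out_degree (quiver A) v)"
    unfolding eq by (subst card_Un_disjoint) (auto simp: X Y)
  moreover have "card (out_arcs G (Old v)) \<le> 2"
    using locally_gentle_blossomed assms by (auto simp: locally_gentle_def out_degree_def)
  ultimately show ?thesis by linarith
qed

text \<open>Among the two arrows that leave \<open>v\<close>, at most one has a zero product with
  \<open>x\<close> and at most one has a nonzero product with \<open>x\<close>, so there is one of
  each kind.\<close>

lemma Z_other_out:
  assumes "x \<in> in_arcs G (Old v)" "y \<in> out_arcs G (Old v)" "y' \<in> out_arcs G (Old v)" "y \<noteq> y'"
  shows "Z x y' \<longleftrightarrow> \<not> Z x y"
proof -
  have "composable (blossomed B) x y" "composable (blossomed B) x y'"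
    using assms by (auto simp: composable_def)
  thus ?thesis
    using bi_unique_Z bi_unique_N N_iff_not_Z assms(4) unfolding bi_unique_def by metis
qed

lemma Z_other_in:
  assumes "x \<in> in_arcs G (Old v)" "x' \<in> in_arcs G (Old v)" "y \<in> out_arcs G (Old v)" "x \<noteq> x'"
  shows "Z x' y \<longleftrightarrow> \<not> Z x y"
proof -
  have "composable (blossomed B) x y" "composable (blossomed B) x' y"
    using assms by (auto simp: composable_def)
  thus ?thesis
    using bi_unique_Z bi_unique_N N_iff_not_Z assms(4) unfolding bi_unique_def by metis
qed

text \<open>The zero products at \<open>v\<close> form a perfect matching of the two incoming with
  the two outgoing arrows. There are only two such matchings, so a single entry of the \<open>2
  \<times> 2\<close> table determines the others.\<close>

lemma Z_checkerboard:
  assumes "x \<in> in_arcs G (Old v)" "x\<^sub>0 \<in> in_arcs G (Old v)"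
    and "y \<in> out_arcs G (Old v)" "y\<^sub>0 \<in> out_arcs G (Old v)"
  shows "Z x y \<longleftrightarrow> (Z x\<^sub>0 y\<^sub>0 \<longleftrightarrow> (x = x\<^sub>0 \<longleftrightarrow> y = y\<^sub>0))"
  using Z_other_in[OF assms(2,1,3)] Z_other_out[OF assms(2,4,3)] by auto

lemma head_in_verts: "x \<in> arcs G \<Longrightarrow> head G x = Old v \<Longrightarrow> v \<in> verts (quiver A)"
  and tail_in_verts: "x \<in> arcs G \<Longrightarrow> tail G x = Old v \<Longrightarrow> v \<in> verts (quiver A)"
proof -
  interpret GG: fin_digraph G by (rule fin_G)
  show "x \<in> arcs G \<Longrightarrow> head G x = Old v \<Longrightarrow> v \<in> verts (quiver A)"
    "x \<in> arcs G \<Longrightarrow> tail G x = Old v \<Longrightarrow> v \<in> verts (quiver A)"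
    using GG.head_in_verts[of x] GG.tail_in_verts[of x] by auto
qed

lemma ex_Z_pred:
  assumes y: "y \<in> arcs G" "y \<notin> range (case_prod New_In)"
  shows "\<exists>x\<in>arcs G. Z x y"
proof -
  obtain v where v: "tail G y = Old v" using y by (cases y) auto
  hence "card (in_arcs G (Old v)) = 2" using card_in_arcs_G tail_in_verts y(1) by blast
  then obtain x x' where "in_arcs G (Old v) = {x, x'}" "x \<noteq> x'" by (auto simp: card_2_iff)
  moreover from this have "x \<in> in_arcs G (Old v)" "x' \<in> in_arcs G (Old v)" by simp_all
  moreover from this have "x \<in> arcs G" "x' \<in> arcs G" by simp_all
  moreover from calculation have "Z x' y \<longleftrightarrow> \<not> Z x y"
    using Z_other_in[of x v x' y] v y by simp
  ultimately show ?thesis by blast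
qed

lemma no_pred_New_In: "\<not> Z x (New_In v i)"
proof -
  have "\<not> composable (blossomed B) x (New_In v i)" by (cases x) (auto simp: composable_def)
  thus ?thesis using composable_if_Z by blast
qed

lemma no_succ_New_Out: "\<not> Z (New_Out v i) x" "\<not> N (New_Out v i) x"
proof -
  have "\<not> composable (blossomed B) (New_Out v i) x" by (cases x) (auto simp: composable_def)
  thus "\<not> Z (New_Out v i) x" "\<not> N (New_Out v i) x" using composable_if_Z composable_if_N by blast+
qed

text \<open>Nothing can precede a new incoming arrow or follow a new outgoing one.\<close>

lemma interior_Old:
  assumes "composable (blossomed B) x y" "composable (blossomed B) y z"
  obtains \<alpha> where "y = Old_Arrow \<alpha>" "\<alpha> \<in> arcs (quiver A)"
proof (cases y)
  case (New_In v i)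
  thus ?thesis using assms by (cases x) (auto simp: composable_def)
next
  case (New_Out v i)
  thus ?thesis using assms by (cases z) (auto simp: composable_def)
qed (use assms that in \<open>auto simp: composable_def\<close>)

lemma sigma_eq:
  assumes "p \<in> labels"
  obtains v i where "sigma B p = New_In v i" "New_In v i \<in> arcs G" "source_label B p = New_Source v i"
proof -
  have "source_label B p \<in> blossom_sources (quiver A)"
    using labelled assms by (auto simp: labelled_blossoming_def bij_betw_def)
  then obtain v i where vi: "source_label B p = New_Source v i" "New_In v i \<in> arcs G"
    by (auto simp: blossom_sources_def)
  have "x = New_In v i" if "x \<in> arcs G" "tail G x = New_Source v i" for x
    using that by (cases x) auto
  hence "sigma B p = New_In v i" unfolding sigma_def vi(1) using vi(2) by (intro the_equality) auto
  thus ?thesis using vi that by blast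
qed

lemma tau_eq:
  assumes "p \<in> labels"
  obtains v i where "tau B p = New_Out v i" "New_Out v i \<in> arcs G" "sink_label B p = New_Sink v i"
proof -
  have "sink_label B p \<in> blossom_sinks (quiver A)"
    using labelled assms by (auto simp: labelled_blossoming_def bij_betw_def)
  then obtain v i where vi: "sink_label B p = New_Sink v i" "New_Out v i \<in> arcs G"
    by (auto simp: blossom_sinks_def)
  have "x = New_Out v i" if "x \<in> arcs G" "head G x = New_Sink v i" for x
    using that by (cases x) auto
  hence "tau B p = New_Out v i" unfolding tau_def vi(1) using vi(2) by (intro the_equality) auto
  thus ?thesis using vi that by blast
qed

lemma sigma_in_arcs: "p \<in> labels \<Longrightarrow> sigma B p \<in> arcs G"
  and tail_sigma: "p \<in> labels \<Longrightarrow> tail G (sigma B p) = source_label B p"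
  and no_pred_sigma: "p \<in> labels \<Longrightarrow> \<nexists>x. Z x (sigma B p)"
  by (erule sigma_eq, simp add: no_pred_New_In)+

lemma tau_in_arcs: "p \<in> labels \<Longrightarrow> tau B p \<in> arcs G"
  and head_tau: "p \<in> labels \<Longrightarrow> head G (tau B p) = sink_label B p"
  and no_succ_tau: "p \<in> labels \<Longrightarrow> \<nexists>x. Z (tau B p) x" "p \<in> labels \<Longrightarrow> \<nexists>x. N (tau B p) x"
  by (erule tau_eq, simp add: no_succ_New_Out)+

lemma sigma_neq_tau: "p \<in> labels \<Longrightarrow> r \<in> labels \<Longrightarrow> sigma B p \<noteq> tau B r"
  by (erule sigma_eq, erule tau_eq) simp

lemma eq_sigma:
  assumes "x \<in> arcs G" "p \<in> labels" "tail G x = source_label B p" shows "x = sigma B p"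
proof -
  obtain v i where "sigma B p = New_In v i" "source_label B p = New_Source v i"
    by (rule sigma_eq[OF assms(2)])
  with assms(1,3) show ?thesis by (cases x) auto
qed

lemma eq_tau:
  assumes "x \<in> arcs G" "p \<in> labels" "head G x = sink_label B p" shows "x = tau B p"
proof -
  obtain v i where "tau B p = New_Out v i" "sink_label B p = New_Sink v i"
    by (rule tau_eq[OF assms(2)])
  with assms(1,3) show ?thesis by (cases x) auto
qed

lemma bij_betw_sigma: "bij_betw (sigma B) labels {x \<in> arcs G. x \<in> range (case_prod New_In)}"
proof (rule bij_betwI')
  fix p r assume "p \<in> labels" "r \<in> labels"
  moreover have "inj_on (source_label B) labels"
    using labelled by (auto simp: labelled_blossoming_def bij_betw_def)
  ultimately show "sigma B p = sigma B r \<longleftrightarrow> p = r"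
    using tail_sigma by (metis inj_onD)
next
  fix p assume "p \<in> labels"
  thus "sigma B p \<in> {x \<in> arcs G. x \<in> range (case_prod New_In)}"
    by (elim sigma_eq) auto
next
  fix x assume x: "x \<in> {x \<in> arcs G. x \<in> range (case_prod New_In)}"
  then obtain v i where vi: "x = New_In v i" by auto
  have "source_label B ` labels = blossom_sources (quiver A)"
    using labelled by (auto simp: labelled_blossoming_def bij_betw_def)
  moreover have "New_Source v i \<in> blossom_sources (quiver A)" using x vi by (auto simp: blossom_sources_def)
  ultimately obtain p where "p \<in> labels" "source_label B p = New_Source v i" by (metis imageE)
  thus "\<exists>p\<in>labels. x = sigma B p" using eq_sigma[of x p] x vi by auto
qed

lemma bij_betw_tau: "bij_betw (tau B) labels {x \<in> arcs G. x \<in> range (case_prod New_Out)}"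
proof (rule bij_betwI')
  fix p r assume "p \<in> labels" "r \<in> labels"
  moreover have "inj_on (sink_label B) labels"
    using labelled by (auto simp: labelled_blossoming_def bij_betw_def)
  ultimately show "tau B p = tau B r \<longleftrightarrow> p = r"
    using head_tau by (metis inj_onD)
next
  fix p assume "p \<in> labels"
  thus "tau B p \<in> {x \<in> arcs G. x \<in> range (case_prod New_Out)}"
    by (elim tau_eq) auto
next
  fix x assume x: "x \<in> {x \<in> arcs G. x \<in> range (case_prod New_Out)}"
  then obtain v i where vi: "x = New_Out v i" by auto
  have "sink_label B ` labels = blossom_sinks (quiver A)"
    using labelled by (auto simp: labelled_blossoming_def bij_betw_def)
  moreover have "New_Sink v i \<in> blossom_sinks (quiver A)" using x vi by (auto simp: blossom_sinks_def)
  ultimately obtain p where "p \<in> labels" "sink_label B p = New_Sink v i" by (metis imageE)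
  thus "\<exists>p\<in>labels. x = tau B p" using eq_tau[of x p] x vi by auto
qed

lemma sigma_inject: "p \<in> labels \<Longrightarrow> r \<in> labels \<Longrightarrow> sigma B p = sigma B r \<longleftrightarrow> p = r"
  and tau_inject: "p \<in> labels \<Longrightarrow> r \<in> labels \<Longrightarrow> tau B p = tau B r \<longleftrightarrow> p = r"
  using bij_betw_sigma bij_betw_tau by (auto simp: bij_betw_def inj_on_eq_iff)

lemma path_between_new_vertices:
  assumes "(source_label B r, xs) \<in> paths G" "path_target G (source_label B r, xs) = sink_label B p"
    and "p \<in> labels" "r \<in> labels"
  shows "xs \<noteq> []" "hd xs = sigma B r" "last xs = tau B p"
proof -
  show ne: "xs \<noteq> []"
  proof
    assume "xs = []"
    moreover obtain v i where "source_label B r = New_Source v i" by (rule sigma_eq[OF assms(4)])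
    moreover obtain w j where "sink_label B p = New_Sink w j" by (rule tau_eq[OF assms(3)])
    ultimately show False using assms(2) by simp
  qed
  show "hd xs = sigma B r" "last xs = tau B p"
    using assms ne nonempty_path_iff[OF ne, of "source_label B r" G] path_target_last[OF ne, of G "source_label B r"]
    by (auto intro!: eq_sigma eq_tau)
qed

lemma N_thread:
  assumes "p \<in> labels"
  shows "\<exists>m. (N ^^ m) (sigma B p) (tau B p)"
proof -
  obtain xs where "maximal (blossomed B) (nonzero_path (blossomed B)) (source_label B p, xs)"
    and target: "path_target G (source_label B p, xs) = sink_label B p"
    using labelled assms unfolding labelled_blossoming_def by blast
  hence xs: "nonzero_path (blossomed B) (source_label B p, xs)" by (simp add: maximal_def)
  have "(source_label B p, xs) \<in> paths G" using xs by (simp add: nonzero_path_def)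
  note path_between_new_vertices[OF this target assms assms]
  moreover have "successively N xs"
    using successively_nonzero_product[OF locally_gentle_blossomed xs] .
  ultimately show ?thesis using successively_imp_relpowp[of xs N] by auto
qed

text \<open>Between a new source and a new sink, maximality is automatic; so the maximal antipaths
  of the blossoming between such vertices are the \<open>Z\<close>-threads.\<close>

lemma maximal_antipath_iff:
  assumes "p \<in> labels" "r \<in> labels"
  shows "maximal (blossomed B) (antipath (blossomed B)) (source_label B r, xs) \<and>
      path_target G (source_label B r, xs) = sink_label B p \<longleftrightarrow>
    xs \<noteq> [] \<and> hd xs = sigma B r \<and> last xs = tau B p \<and> successively Z xs" (is "?L \<longleftrightarrow> ?R")
proof
  assume L: ?L
  hence a: "antipath (blossomed B) (source_label B r, xs)" by (simp add: maximal_def)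
  hence "(source_label B r, xs) \<in> paths G" by (simp add: antipath_def)
  note path_between_new_vertices[OF this conjunct2[OF L] assms]
  thus ?R using a by (simp add: antipath_def)
next
  assume R: ?R
  interpret GG: fin_digraph G by (rule fin_G)
  have "set xs \<subseteq> arcs G"
    using R sigma_in_arcs[OF assms(2)] composable_if_Z
    by (intro successively_subset[where R=Z]) (auto simp: composable_def)
  hence "antipath (blossomed B) (source_label B r, xs)"
    using R assms GG.tail_in_verts[OF sigma_in_arcs[OF assms(2)]]
    by (simp add: antipath_iff tail_sigma)
  moreover have "head G \<alpha> \<noteq> source_label B r" for \<alpha>
  proof -
    obtain v i where "source_label B r = New_Source v i" by (rule sigma_eq[OF assms(2)])
    thus ?thesis by (cases \<alpha>) auto
  qed
  moreover have "\<not> antipath (blossomed B) (source_label B r, xs @ [\<alpha>])" for \<alpha>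
    using R no_succ_tau[OF assms(1)] by (auto simp: antipath_def successively_append_iff)
  ultimately show ?L using R assms
    by (simp add: maximal_def path_target_last head_tau)
qed

lemma ex_Z_thread:
  assumes "p \<in> labels"
  shows "\<exists>r\<in>labels. \<exists>m. (Z ^^ m) (sigma B r) (tau B p)"
proof -
  interpret GG: fin_digraph G by (rule fin_G)
  have "right_unique Z" using bi_unique_Z by (simp add: bi_unique_alt_def)
  from relpowp_reaches_initial[OF GG.finite_arcs this tau_in_arcs[OF assms] no_succ_tau(1)[OF assms] ex_Z_pred]
  obtain s m where s: "s \<in> range (case_prod New_In) \<inter> arcs G" "(Z ^^ m) s (tau B p)" by blast
  have "s \<in> sigma B ` labels" using s(1) bij_betw_imp_surj_on[OF bij_betw_sigma] by blast
  thus ?thesis using s(2) by blast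
qed

lemma Z_thread_unique:
  assumes "(Z ^^ m) (sigma B r) (tau B p)" "(Z ^^ n) (sigma B r') (tau B p')" "p = p' \<or> r = r'"
    and "p \<in> labels" "p' \<in> labels" "r \<in> labels" "r' \<in> labels"
  shows "m = n \<and> p = p' \<and> r = r'"
  using assms(3)
proof
  assume "p = p'"
  hence "m = n \<and> sigma B r = sigma B r'"
    using assms bi_unique_Z
    by (intro relpowp_initial_unique[of Z m _ "tau B p"]) (simp_all add: bi_unique_alt_def no_pred_sigma)
  thus ?thesis using \<open>p = p'\<close> assms sigma_inject by simp
next
  assume "r = r'"
  hence "m = n \<and> tau B p = tau B p'"
    using assms bi_unique_Z
    by (intro relpowp_terminal_unique[of Z m "sigma B r"]) (simp_all add: bi_unique_alt_def no_succ_tau)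
  thus ?thesis using \<open>r = r'\<close> assms tau_inject by simp
qed

lemma ex_maximal_antipath_iff:
  assumes "p \<in> labels" "r \<in> labels"
  shows "(\<exists>xs. maximal (blossomed B) (antipath (blossomed B)) (source_label B r, xs) \<and>
      path_target G (source_label B r, xs) = sink_label B p) \<longleftrightarrow> (\<exists>m. (Z ^^ m) (sigma B r) (tau B p))"
  unfolding maximal_antipath_iff[OF assms]
  by (metis successively_imp_relpowp relpowp_imp_successively length_0_conv nat.distinct(1))

lemma AG_perm_eqI:
  assumes "(Z ^^ m) (sigma B r) (tau B p)" "p \<in> labels" "r \<in> labels"
  shows "AG_perm A B p = r"
  unfolding AG_perm_def
proof (rule the_equality)
  show "r \<in> labels \<and> (\<exists>xs. maximal (blossomed B) (antipath (blossomed B)) (source_label B r, xs) \<and>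
           path_target G (source_label B r, xs) = sink_label B p)"
    using assms ex_maximal_antipath_iff by blast
next
  fix s assume s: "s \<in> labels \<and> (\<exists>xs. maximal (blossomed B) (antipath (blossomed B)) (source_label B s, xs) \<and>
           path_target G (source_label B s, xs) = sink_label B p)"
  then obtain n where "(Z ^^ n) (sigma B s) (tau B p)"
    using ex_maximal_antipath_iff[of p s] assms by blast
  thus "s = r" using Z_thread_unique[OF assms(1), of n s p] s assms by simp
qed

lemma AG_perm_in_labels: "p \<in> labels \<Longrightarrow> AG_perm A B p \<in> labels"
  and AG_perm_thread: "p \<in> labels \<Longrightarrow> \<exists>m. (Z ^^ m) (sigma B (AG_perm A B p)) (tau B p)"
  using ex_Z_thread AG_perm_eqI by blast+

lemma bij_betw_AG_perm: "bij_betw (AG_perm A B) labels labels"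
proof -
  have "inj_on (AG_perm A B) labels"
    using AG_perm_thread Z_thread_unique AG_perm_in_labels by (intro inj_onI) metis
  thus ?thesis
    using AG_perm_in_labels by (intro bij_betw_imageI endo_inj_surj) auto
qed

text \<open>The \<open>Z\<close>-thread that ends in \<open>\<tau>\<^sub>p\<close> has the form
  required of \<open>\<sigma> \<delta> \<tau>\<close> because each of its interior arrows has both
  a predecessor and a successor and is therefore an old arrow. The description of
  \<open>AG_delta\<close> determines it because the thread is determined by its first
  arrow.\<close>

lemma AG_delta_props:
  assumes p: "p \<in> labels"
  defines "r \<equiv> AG_perm A B p" and "x \<equiv> AG_delta A B p"
  shows "x \<in> paths (quiver A)" "head G (sigma B r) = Old (fst x)"
    and "successively Z (sigma B r # map Old_Arrow (snd x) @ [tau B p])"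
proof -
  have r: "r \<in> labels" unfolding r_def by (rule AG_perm_in_labels[OF p])
  let ?P = "\<lambda>x. x \<in> paths (quiver A) \<and> head G (sigma B r) = Old (fst x) \<and>
     maximal (blossomed B) (antipath (blossomed B))
       (source_label B r, [sigma B r] @ map Old_Arrow (snd x) @ [tau B p])"
  have P: "?P y \<longleftrightarrow> y \<in> paths (quiver A) \<and> head G (sigma B r) = Old (fst y) \<and>
     successively Z (sigma B r # map Old_Arrow (snd y) @ [tau B p])" for y
    using maximal_antipath_iff[OF p r, of "[sigma B r] @ map Old_Arrow (snd y) @ [tau B p]"] p
    by (simp add: path_target_last head_tau)
  obtain m where "(Z ^^ m) (sigma B r) (tau B p)" using AG_perm_thread[OF p] unfolding r_def by blast
  then obtain xs where xs: "length xs = Suc m" "successively Z xs" "hd xs = sigma B r" "last xs = tau B p"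
    by (rule relpowp_imp_successively)
  obtain ys where xs_eq: "xs = sigma B r # ys @ [tau B p]"
  proof -
    obtain us where "xs = sigma B r # us" using xs(1,3) by (cases xs) auto
    moreover from this have "us \<noteq> []" using xs(4) sigma_neq_tau[OF r p] by auto
    moreover from calculation have "last us = tau B p" using xs(4) by simp
    ultimately show ?thesis using that[of "butlast us"] by (metis append_butlast_last_id)
  qed
  have "\<exists>\<alpha>. y = Old_Arrow \<alpha>" if "y \<in> set ys" for y
    using successively_interior[of Z "sigma B r" ys "tau B p" y] that xs(2) xs_eq
      interior_Old composable_if_Z by metis
  hence "ys = map Old_Arrow (map (\<lambda>y. SOME \<alpha>. y = Old_Arrow \<alpha>) ys)"
    by (subst map_map, intro map_idI[symmetric]) (metis (mono_tags, lifting) comp_apply someI_ex)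
  then obtain zs where zs: "ys = map Old_Arrow zs" by blast
  obtain v i where vi: "sigma B r = New_In v i" "New_In v i \<in> arcs G" by (rule sigma_eq[OF r])
  have v: "v \<in> verts (quiver A)" using vi by simp
  have succ: "successively Z (sigma B r # map Old_Arrow zs @ [tau B p])" using xs(2) xs_eq zs by simp
  have "(v, zs) \<in> paths (quiver A)"
  proof (cases "zs = []")
    case True
    thus ?thesis using v by (simp add: paths_iff pre_digraph.cas.simps)
  next
    case False
    have "composable (blossomed B) (New_In v i) (Old_Arrow (hd zs))"
      using succ False vi(1) composable_if_Z by (cases zs) auto
    hence hd: "tail (quiver A) (hd zs) = v" "hd zs \<in> arcs (quiver A)" by (simp_all add: composable_def)
    have "successively Z (map Old_Arrow zs)" using succ False by (simp add: successively_append_iff successively_Cons)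
    hence "successively (\<lambda>a b. Z (Old_Arrow a) (Old_Arrow b)) zs" by (simp add: successively_map)
    hence *: "successively (\<lambda>a b. head (quiver A) a = tail (quiver A) b \<and> b \<in> arcs (quiver A)) zs"
      by (rule successively_mono) (auto dest!: composable_if_Z simp: composable_def)
    have "set zs \<subseteq> arcs (quiver A)" by (rule successively_subset[OF False hd(2) *]) auto
    moreover have "successively (\<lambda>a b. head (quiver A) a = tail (quiver A) b) zs"
      using * by (rule successively_mono) auto
    ultimately show ?thesis using False hd v by (simp add: nonempty_path_iff)
  qed
  hence ex: "?P (v, zs)" unfolding P using succ vi by simp
  have "?P x" unfolding x_def AG_delta_def r_def[symmetric]
  proof (rule theI[of ?P])
    show "?P (v, zs)" by (rule ex)
    fix y assume y: "?P y"
    have th: "(Z ^^ Suc (length (snd y))) (sigma B r) (tau B p)" if "?P y" for y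
      using successively_imp_relpowp[of "sigma B r # map Old_Arrow (snd y) @ [tau B p]" Z] that
      unfolding P by simp
    have len: "length (snd y) = length zs"
      using Z_thread_unique[OF th[OF y] th[OF ex]] p r by simp
    have "map Old_Arrow (snd y) @ [tau B p] = map Old_Arrow zs @ [tau B p]"
      using y ex bi_unique_Z unfolding P
      by (intro successively_unique[of Z "sigma B r"]) (auto simp: bi_unique_alt_def len)
    hence "snd y = zs" by (auto dest: map_injective simp: inj_def)
    moreover have "fst y = v" using y vi by simp
    ultimately show "y = (v, zs)" by (cases y) simp
  qed
  thus "x \<in> paths (quiver A)" "head G (sigma B r) = Old (fst x)"
    "successively Z (sigma B r # map Old_Arrow (snd x) @ [tau B p])" unfolding P by blast+
qed

lemma AG_delta_thread:
  assumes "p \<in> labels"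
  shows "(Z ^^ Suc (length (snd (AG_delta A B p)))) (sigma B (AG_perm A B p)) (tau B p)"
  using successively_imp_relpowp[OF _ AG_delta_props(3)[OF assms]] by simp

text \<open>If \<open>\<delta>\<^sub>p\<close> is not trivial, then its last arrow determines
  \<open>\<tau>\<^sub>p\<close>. If it is the trivial path at \<open>v\<close> for two labels,
  then the two arrows \<open>\<sigma>\<close> and the two arrows \<open>\<tau>\<close> in question
  are all the arrows at \<open>v\<close>, so that \<open>v\<close> would be isolated in
  \<open>A\<close>.\<close>

lemma inj_on_AG_delta: "inj_on (AG_delta A B) labels"
proof (rule inj_onI)
  fix p r assume p: "p \<in> labels" and r: "r \<in> labels" and eq: "AG_delta A B p = AG_delta A B r"
  let ?x = "AG_delta A B p" and ?s = "sigma B (AG_perm A B p)" and ?s' = "sigma B (AG_perm A B r)"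
  note dp = AG_delta_props[OF p] and dr = AG_delta_props[OF r, folded eq]
  have "tau B p = tau B r"
  proof (cases "snd ?x = []")
    case False
    hence "Z (last (map Old_Arrow (snd ?x))) (tau B p)" "Z (last (map Old_Arrow (snd ?x))) (tau B r)"
      using dp(3) dr(3) by (simp_all add: successively_append_iff successively_Cons)
    thus ?thesis using bi_unique_Z by (auto simp: bi_unique_def)
  next
    case True
    hence Z: "Z ?s (tau B p)" "Z ?s' (tau B r)" using dp(3) dr(3) by simp_all
    show ?thesis
    proof (rule ccontr)
      assume ne: "tau B p \<noteq> tau B r"
      hence ne': "?s \<noteq> ?s'" using Z bi_unique_Z by (auto simp: bi_unique_def)
      define v where "v = fst ?x"
      have io: "{?s, ?s'} \<subseteq> in_arcs G (Old v)" "{tau B p, tau B r} \<subseteq> out_arcs G (Old v)"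
        using dp(2) dr(2) composable_if_Z[OF Z(1)] composable_if_Z[OF Z(2)]
        by (auto simp: composable_def v_def)
      have v: "v \<in> verts (quiver A)" using io(1) head_in_verts by auto
      interpret GG: fin_digraph G by (rule fin_G)
      have "in_arcs G (Old v) = {?s, ?s'}" "out_arcs G (Old v) = {tau B p, tau B r}"
        using card_in_arcs_G[OF v] card_out_arcs_G[OF v] io ne ne'
        by (metis GG.finite_in_arcs card_2_iff card_subset_eq, metis GG.finite_out_arcs card_2_iff card_subset_eq)
      moreover obtain \<alpha> where "Old_Arrow \<alpha> \<in> in_arcs G (Old v) \<or> Old_Arrow \<alpha> \<in> out_arcs G (Old v)"
        using incident[OF v] by auto
      moreover have "Old_Arrow \<alpha> \<notin> {?s, ?s'}" "Old_Arrow \<alpha> \<notin> {tau B p, tau B r}"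
        using sigma_eq[OF AG_perm_in_labels[OF p]] sigma_eq[OF AG_perm_in_labels[OF r]] tau_eq[OF p] tau_eq[OF r]
        by (metis blossom_arrow.distinct insertE singletonD)+
      ultimately show False by blast
    qed
  qed
  thus "p = r" using tau_inject[OF p r] by simp
qed

abbreviation "AG_length p \<equiv> length (snd (AG_delta A B p))"

text \<open>By injectivity, the sets of paths \<open>AG_orbits\<close> may be replaced by the sets
  of labels that form the orbits of \<open>AG_perm\<close>.\<close>

lemma mult_AG_number:
  "q * AG_number A B q l =
    card {p \<in> labels. card (orbit (AG_perm A B) p) = q \<and> sum AG_length (orbit (AG_perm A B) p) = l}"
proof -
  let ?O = "orbit (AG_perm A B) ` labels" and ?\<delta> = "AG_delta A B"
  have sub: "X \<subseteq> labels" if "X \<in> ?O" for X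
    using that self_in_orbit_bij_betw(2)[OF _ bij_betw_AG_perm] by blast
  have inj: "inj_on ?\<delta> X" if "X \<in> ?O" for X
    using inj_on_AG_delta sub[OF that] by (rule inj_on_subset)
  have "AG_orbits A B = (`) ?\<delta> ` ?O" by (simp add: AG_orbits_def image_image)
  hence "{X \<in> AG_orbits A B. card X = q \<and> (\<Sum>x\<in>X. length (snd x)) = l} =
     (`) ?\<delta> ` {X \<in> ?O. card X = q \<and> sum AG_length X = l}"
    using inj by (auto simp: card_image sum.reindex)
  moreover have "inj_on ((`) ?\<delta>) {X \<in> ?O. card X = q \<and> sum AG_length X = l}"
    using inj_on_image_Pow[OF inj_on_AG_delta] sub by (rule_tac inj_on_subset) auto
  ultimately have "AG_number A B q l = card {X \<in> ?O. card X = q \<and> sum AG_length X = l}"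
    by (simp add: AG_number_def card_image)
  thus ?thesis using card_points_in_orbits_of_type[OF _ bij_betw_AG_perm] by simp
qed

text \<open>An orbit with one element is a label whose \<open>Z\<close>-thread starts and ends at
  that label; the arrows \<open>\<sigma>\<close> and \<open>\<tau>\<close> at its two ends account
  for one step more than the length.\<close>

lemma AG_number_1: "AG_number A B 1 l = card {p \<in> labels. (Z ^^ Suc l) (sigma B p) (tau B p)}"
proof -
  have "card (orbit (AG_perm A B) p) = 1 \<and> sum AG_length (orbit (AG_perm A B) p) = l \<longleftrightarrow>
      (Z ^^ Suc l) (sigma B p) (tau B p)" (is "?L \<longleftrightarrow> ?R") if p: "p \<in> labels" for p
  proof
    assume L: ?L
    hence o: "orbit (AG_perm A B) p = {p}"
      using self_in_orbit_bij_betw(1)[OF _ bij_betw_AG_perm p] by (auto simp: card_1_singleton_iff)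
    hence "AG_perm A B p = p" by (simp add: orbit_eq_singleton_iff)
    moreover have "AG_length p = l" using L unfolding o by simp
    ultimately show ?R using AG_delta_thread[OF p] by simp
  next
    assume R: ?R
    hence fixp: "AG_perm A B p = p" using AG_perm_eqI p by blast
    hence "orbit (AG_perm A B) p = {p}" by (simp add: orbit_eq_singleton_iff)
    moreover have "AG_length p = l"
      using Z_thread_unique[OF R AG_delta_thread[OF p]] p fixp by simp
    ultimately show ?L by simp
  qed
  thus ?thesis using mult_AG_number[of 1 l] by (simp cong: conj_cong)
qed

end


section \<open>Threads in a repetition\<close>

text \<open>A walk from the end of some arrow to \<open>v\<close> is trivial or has a last
  arrow.\<close>

lemma connected_imp_incident:
  assumes "connected Q" "arcs Q \<noteq> {}" "wf_digraph Q" "v \<in> verts Q"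
  shows "\<exists>\<alpha>\<in>arcs Q. tail Q \<alpha> = v \<or> head Q \<alpha> = v"
proof -
  obtain \<alpha> where \<alpha>: "\<alpha> \<in> arcs Q" using assms(2) by blast
  hence "tail Q \<alpha> \<in> verts Q" using assms(3) by (simp add: wf_digraph.tail_in_verts)
  hence "(tail Q \<alpha>, v) \<in> rtrancl_on (verts Q) ((arcs_ends Q)\<^sup>s)"
    using assms(1,4) by (simp add: connected_conv)
  thus ?thesis
  proof (cases rule: rtrancl_on.cases)
    case rtrancl_on_refl
    thus ?thesis using \<alpha> by blast
  next
    case (rtrancl_on_into_rtrancl_on b)
    thus ?thesis by (auto simp: symcl_def arcs_ends_conv)
  qed
qed

locale blossomed_repetition = blossomed_quiver A B
  for A :: "('v, 'a, 'k::field) bound_quiver" and B :: "('v, 'a, 'k) blossoming" +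
  fixes k :: nat and C :: "('v \<times> nat, 'a repetition_arrow, 'k) blossoming"
  assumes k: "k \<ge> 1" and labelled_repetition: "labelled_blossoming (repetition A B k) C"
begin

abbreviation "Q\<^sub>k \<equiv> repetition_quiver A B k"

lemma quiver_repetition [simp]: "quiver (repetition A B k) = Q\<^sub>k"
  by (simp add: repetition_def)

lemma tail_Q\<^sub>k [simp]:
    "tail Q\<^sub>k (Copy \<alpha> i) = (tail (quiver A) \<alpha>, i)"
    "tail Q\<^sub>k (Conn p i) = (base (tail G (tau B p)), i)"
  and head_Q\<^sub>k [simp]:
    "head Q\<^sub>k (Copy \<alpha> i) = (head (quiver A) \<alpha>, i)"
    "head Q\<^sub>k (Conn p i) = (base (head G (sigma B p)), i + 1)"
  and verts_Q\<^sub>k [simp]: "verts Q\<^sub>k = verts (quiver A) \<times> {1..k}"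
  and arcs_Q\<^sub>k [simp]:
    "Copy \<alpha> i \<in> arcs Q\<^sub>k \<longleftrightarrow> \<alpha> \<in> arcs (quiver A) \<and> i \<in> {1..k}"
    "Conn p i \<in> arcs Q\<^sub>k \<longleftrightarrow> p \<in> labels \<and> i \<in> {1..<k}"
  by (auto simp: repetition_quiver_def)

lemma base_head_sigma:
  assumes "p \<in> labels"
  shows "base (head G (sigma B p)) \<in> verts (quiver A)"
proof -
  obtain v i where "sigma B p = New_In v i" "New_In v i \<in> arcs G" by (rule sigma_eq[OF assms])
  thus ?thesis by simp
qed

lemma base_tail_tau:
  assumes "p \<in> labels"
  shows "base (tail G (tau B p)) \<in> verts (quiver A)"
proof -
  obtain v i where "tau B p = New_Out v i" "New_Out v i \<in> arcs G" by (rule tau_eq[OF assms])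
  thus ?thesis by simp
qed

lemma fin_digraph_repetition: "fin_digraph Q\<^sub>k"
proof -
  interpret QQ: fin_digraph "quiver A" by (rule fin)
  have arcs: "arcs Q\<^sub>k \<subseteq> case_prod Copy ` (arcs (quiver A) \<times> {1..k}) \<union> case_prod Conn ` (labels \<times> {1..<k})"
    by (auto simp: repetition_quiver_def)
  show ?thesis
  proof
    show "finite (arcs Q\<^sub>k)" by (rule finite_subset[OF arcs]) auto
    fix x assume "x \<in> arcs Q\<^sub>k"
    thus "tail Q\<^sub>k x \<in> verts Q\<^sub>k" "head Q\<^sub>k x \<in> verts Q\<^sub>k"
      using base_head_sigma base_tail_tau by (cases x; auto)+
  qed auto
qed

sublocale rep: blossomed_quiver "repetition A B k" C
proof (rule blossomed_quiver.intro)
  fix v assume "v \<in> verts (quiver (repetition A B k))"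
  then obtain a i where v: "v = (a, i)" "a \<in> verts (quiver A)" "i \<in> {1..k}" by auto
  from incident[OF v(2)] obtain \<alpha> where "\<alpha> \<in> arcs (quiver A)" "tail (quiver A) \<alpha> = a \<or> head (quiver A) \<alpha> = a" by blast
  thus "\<exists>\<alpha>\<in>arcs (quiver (repetition A B k)). tail (quiver (repetition A B k)) \<alpha> = v \<or>
      head (quiver (repetition A B k)) \<alpha> = v"
    using v by (intro bexI[of _ "Copy \<alpha> i"]) auto
qed (use fin_digraph_repetition labelled_repetition in auto)

lemma zero_product_repetition:
  "zero_product (repetition A B k) x y \<longleftrightarrow> (x, y) \<in> repetition_relations A B k"
  unfolding repetition_def
proof (rule zero_product_genideal[OF fin_digraph_repetition])
  fix x y assume xy: "(x, y) \<in> repetition_relations A B k"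
  have comp: "head G x = tail G y" if "Z x y" for x y
    using composable_if_Z[OF that] by (simp add: composable_def)
  show "x \<in> arcs Q\<^sub>k \<and> y \<in> arcs Q\<^sub>k \<and> head Q\<^sub>k x = tail Q\<^sub>k y"
    using xy unfolding repetition_relations_def
  proof (elim UnE CollectE exE conjE, goal_cases)
    case (1 \<alpha> \<beta> i)
    thus ?case by (auto simp: zero_product_def composable_def)
  next
    case (2 \<alpha> p i)
    from arg_cong[OF comp[OF 2(5)], of base] 2 show ?case by simp
  next
    case (3 p \<beta> i)
    from arg_cong[OF comp[OF 3(5)], of base] 3 show ?case by simp
  next
    case (4 p r i)
    from comp[OF 4(6)] 4 show ?case by simp
  qed
qed

lemma rep_Z_Old_iff:
  assumes "x \<in> arcs Q\<^sub>k" "y \<in> arcs Q\<^sub>k" "head Q\<^sub>k x = tail Q\<^sub>k y"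
  shows "rep.Z (Old_Arrow x) (Old_Arrow y) \<longleftrightarrow> (x, y) \<in> repetition_relations A B k"
  using rep.Z_Old_iff[of x y] assms by (simp add: composable_def zero_product_repetition)

text \<open>A vertex \<open>v\<close> without incoming arrows in \<open>A\<close> carries two new
  incoming arrows in the blossoming of \<open>A\<close>, and \<open>(v, 1)\<close> carries two in
  that of the repetition. The relations at these four arrows are chosen independently, so the
  choices may disagree with the numbering \<open>0, 1\<close> of the arrows. This predicate tells
  where the two numbers have to be exchanged; \<open>swap_sinks\<close> does the same for outgoing
  arrows in the last layer.\<close>

definition swap_sources :: "'v \<Rightarrow> bool" where
  "swap_sources v \<longleftrightarrow> in_degree (quiver A) v = 0 \<and>
     (\<exists>\<beta>\<in>out_arcs (quiver A) v. Z (New_In v 0) (Old_Arrow \<beta>) \<noteq>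
        rep.Z (New_In (v, 1) 0) (Old_Arrow (Copy \<beta> 1)))"

definition swap_sinks :: "'v \<Rightarrow> bool" where
  "swap_sinks v \<longleftrightarrow> out_degree (quiver A) v = 0 \<and>
     (\<exists>\<alpha>\<in>in_arcs (quiver A) v. Z (Old_Arrow \<alpha>) (New_Out v 0) \<noteq>
        rep.Z (Old_Arrow (Copy \<alpha> k)) (New_Out (v, k) 0))"

text \<open>\<open>in_copy i x\<close> is the arrow that plays the role of \<open>x\<close> among
  the arrows \<^emph>\<open>into\<close> the vertices of layer \<open>i\<close>: a copy of
  \<open>x\<close>, or, for \<open>x = \<sigma>\<^sub>p\<close> beyond the first layer, the
  connecting arrow with label \<open>p\<close> from the layer before. Dually, \<open>out_copy i
  y\<close> plays the role of \<open>y\<close> among the arrows out of these vertices, so that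
  \<open>\<tau>\<^sub>p\<close> becomes the connecting arrow to the next layer unless \<open>i =
  k\<close>. Thus \<open>in_copy\<close> is meant for arrows other than the
  \<open>\<tau>\<^sub>p\<close>, and \<open>out_copy\<close> for arrows other than the
  \<open>\<sigma>\<^sub>p\<close>.\<close>

definition in_copy :: "nat \<Rightarrow> ('v, 'a) blossom_arrow \<Rightarrow> ('v \<times> nat, 'a repetition_arrow) blossom_arrow" where
  "in_copy i x = (case x of
       Old_Arrow \<alpha> \<Rightarrow> Old_Arrow (Copy \<alpha> i)
     | New_In v j \<Rightarrow> if i = 1 then New_In (v, 1) (if swap_sources v then 1 - j else j)
                    else Old_Arrow (Conn (inv_into labels (sigma B) x) (i - 1))
     | New_Out v j \<Rightarrow> undefined)"

definition out_copy :: "nat \<Rightarrow> ('v, 'a) blossom_arrow \<Rightarrow> ('v \<times> nat, 'a repetition_arrow) blossom_arrow" where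
  "out_copy i x = (case x of
       Old_Arrow \<alpha> \<Rightarrow> Old_Arrow (Copy \<alpha> i)
     | New_In v j \<Rightarrow> undefined
     | New_Out v j \<Rightarrow> if i = k then New_Out (v, k) (if swap_sinks v then 1 - j else j)
                     else Old_Arrow (Conn (inv_into labels (tau B) x) i))"

lemma in_copy_Old [simp]: "in_copy i (Old_Arrow \<alpha>) = Old_Arrow (Copy \<alpha> i)"
  and out_copy_Old [simp]: "out_copy i (Old_Arrow \<alpha>) = Old_Arrow (Copy \<alpha> i)"
  by (simp_all add: in_copy_def out_copy_def)

lemma in_copy_New_In: "in_copy 1 (New_In v j) = New_In (v, 1) (if swap_sources v then 1 - j else j)"
  and out_copy_New_Out: "out_copy k (New_Out v j) = New_Out (v, k) (if swap_sinks v then 1 - j else j)"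
  by (simp_all add: in_copy_def out_copy_def)

lemma in_copy_sigma:
  assumes "p \<in> labels" "i \<noteq> 1"
  shows "in_copy i (sigma B p) = Old_Arrow (Conn p (i - 1))"
proof -
  obtain v j where "sigma B p = New_In v j" by (rule sigma_eq[OF assms(1)])
  moreover have "inv_into labels (sigma B) (sigma B p) = p"
    using bij_betw_sigma assms(1) by (intro inv_into_f_f) (auto simp: bij_betw_def)
  ultimately show ?thesis using assms(2) by (simp add: in_copy_def)
qed

lemma out_copy_tau:
  assumes "p \<in> labels" "i \<noteq> k"
  shows "out_copy i (tau B p) = Old_Arrow (Conn p i)"
proof -
  obtain v j where "tau B p = New_Out v j" by (rule tau_eq[OF assms(1)])
  moreover have "inv_into labels (tau B) (tau B p) = p"
    using bij_betw_tau assms(1) by (intro inv_into_f_f) (auto simp: bij_betw_def)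
  ultimately show ?thesis using assms(2) by (simp add: out_copy_def)
qed

lemma New_In_eq_sigma:
  assumes "New_In v j \<in> arcs G" obtains p where "p \<in> labels" "sigma B p = New_In v j"
proof -
  have "New_In v j \<in> sigma B ` labels"
    unfolding bij_betw_imp_surj_on[OF bij_betw_sigma] using assms by force
  thus ?thesis using that by auto
qed

lemma New_Out_eq_tau:
  assumes "New_Out v j \<in> arcs G" obtains p where "p \<in> labels" "tau B p = New_Out v j"
proof -
  have "New_Out v j \<in> tau B ` labels"
    unfolding bij_betw_imp_surj_on[OF bij_betw_tau] using assms by force
  thus ?thesis using that by auto
qed

lemma in_degree_first_layer: "in_degree Q\<^sub>k (v, 1) = in_degree (quiver A) v"
proof -
  have "in_arcs Q\<^sub>k (v, 1) = (\<lambda>\<alpha>. Copy \<alpha> 1) ` in_arcs (quiver A) v"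
  proof (intro equalityI subsetI)
    fix x assume "x \<in> in_arcs Q\<^sub>k (v, 1)"
    thus "x \<in> (\<lambda>\<alpha>. Copy \<alpha> 1) ` in_arcs (quiver A) v" by (cases x) auto
  qed (use k in auto)
  thus ?thesis by (simp add: in_degree_def card_image inj_on_def)
qed

lemma out_degree_last_layer: "out_degree Q\<^sub>k (v, k) = out_degree (quiver A) v"
proof -
  have "out_arcs Q\<^sub>k (v, k) = (\<lambda>\<alpha>. Copy \<alpha> k) ` out_arcs (quiver A) v"
  proof (intro equalityI subsetI)
    fix x assume "x \<in> out_arcs Q\<^sub>k (v, k)"
    thus "x \<in> (\<lambda>\<alpha>. Copy \<alpha> k) ` out_arcs (quiver A) v" by (cases x) auto
  qed (use k in auto)
  thus ?thesis by (simp add: out_degree_def card_image inj_on_def)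
qed

lemma in_copy_in_arcs:
  assumes "x \<in> in_arcs G (Old v)" "i \<in> {1..k}"
  shows "in_copy i x \<in> in_arcs rep.G (Old (v, i))"
proof (cases x)
  case (New_In w j)
  hence w: "w = v" "New_In v j \<in> arcs G" using assms(1) by auto
  show ?thesis
  proof (cases "i = 1")
    case True
    thus ?thesis using New_In w assms(2) in_degree_first_layer[of v] k
      by (auto simp: in_copy_New_In swap_sources_def simp del: One_nat_def)
  next
    case False
    obtain p where p: "p \<in> labels" "sigma B p = New_In v j" by (rule New_In_eq_sigma[OF w(2)])
    have "in_copy i x = Old_Arrow (Conn p (i - 1))"
      using in_copy_sigma[OF p(1) False] p(2) New_In w by simp
    thus ?thesis using p False assms(2) by auto
  qed
qed (use assms in auto)

lemma out_copy_out_arcs: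
  assumes "y \<in> out_arcs G (Old v)" "i \<in> {1..k}"
  shows "out_copy i y \<in> out_arcs rep.G (Old (v, i))"
proof (cases y)
  case (New_Out w j)
  hence w: "w = v" "New_Out v j \<in> arcs G" using assms(1) by auto
  show ?thesis
  proof (cases "i = k")
    case True
    thus ?thesis using New_Out w assms(2) out_degree_last_layer[of v] k
      by (auto simp: out_copy_New_Out swap_sinks_def simp del: One_nat_def)
  next
    case False
    obtain p where p: "p \<in> labels" "tau B p = New_Out v j" by (rule New_Out_eq_tau[OF w(2)])
    have "out_copy i y = Old_Arrow (Conn p i)"
      using out_copy_tau[OF p(1) False] p(2) New_Out w by simp
    thus ?thesis using p False assms(2) by auto
  qed
qed (use assms in auto)

lemma in_copy_inject:
  assumes "x \<in> in_arcs G (Old v)" "y \<in> in_arcs G (Old v)" "in_copy i x = in_copy i y"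
  shows "x = y"
proof (cases "i = 1")
  case True
  with assms show ?thesis
    by (cases x; cases y) (auto simp: in_copy_New_In[unfolded One_nat_def] split: if_splits)
next
  case False
  have 1: "\<exists>p. in_copy i z = Old_Arrow (Conn p (i - 1)) \<and> p \<in> labels \<and> z = sigma B p"
    if "z \<in> arcs G" "z = New_In w j" for z w j
    using New_In_eq_sigma[of w j] in_copy_sigma[OF _ False] that by metis
  show ?thesis
  proof (cases x; cases y)
    fix w j w' j' assume xy: "x = New_In w j" "y = New_In w' j'"
    have "x \<in> arcs G" "y \<in> arcs G" using assms by auto
    then obtain p r where "in_copy i x = Old_Arrow (Conn p (i - 1))" "x = sigma B p"
      "in_copy i y = Old_Arrow (Conn r (i - 1))" "y = sigma B r"
      using 1[OF _ xy(1)] 1[OF _ xy(2)] by blast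
    thus ?thesis using assms(3) by (metis blossom_arrow.inject(1) repetition_arrow.inject(2))
  next
    fix \<alpha> w' j' assume "x = Old_Arrow \<alpha>" "y = New_In w' j'"
    thus ?thesis using 1[of y w' j'] assms by auto
  next
    fix \<alpha> w' j' assume "y = Old_Arrow \<alpha>" "x = New_In w' j'"
    thus ?thesis using 1[of x w' j'] assms by auto
  qed (use assms in auto)
qed

lemma out_copy_inject:
  assumes "x \<in> out_arcs G (Old v)" "y \<in> out_arcs G (Old v)" "out_copy i x = out_copy i y"
  shows "x = y"
proof (cases "i = k")
  case True
  with assms show ?thesis
    by (cases x; cases y) (auto simp: out_copy_New_Out split: if_splits)
next
  case False
  have 1: "\<exists>p. out_copy i z = Old_Arrow (Conn p i) \<and> p \<in> labels \<and> z = tau B p"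
    if "z \<in> arcs G" "z = New_Out w j" for z w j
    using New_Out_eq_tau[of w j] out_copy_tau[OF _ False] that by metis
  show ?thesis
  proof (cases x; cases y)
    fix w j w' j' assume xy: "x = New_Out w j" "y = New_Out w' j'"
    have "x \<in> arcs G" "y \<in> arcs G" using assms by auto
    then obtain p r where "out_copy i x = Old_Arrow (Conn p i)" "x = tau B p"
      "out_copy i y = Old_Arrow (Conn r i)" "y = tau B r"
      using 1[OF _ xy(1)] 1[OF _ xy(2)] by blast
    thus ?thesis using assms(3) by (metis blossom_arrow.inject(1) repetition_arrow.inject(2))
  next
    fix \<alpha> w' j' assume "x = Old_Arrow \<alpha>" "y = New_Out w' j'"
    thus ?thesis using 1[of y w' j'] assms by auto
  next
    fix \<alpha> w' j' assume "y = Old_Arrow \<alpha>" "x = New_Out w' j'"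
    thus ?thesis using 1[of x w' j'] assms by auto
  qed (use assms in auto)
qed

lemma Z_Old_Old_copy:
  assumes "\<alpha> \<in> in_arcs (quiver A) v" "\<beta> \<in> out_arcs (quiver A) v" "i \<in> {1..k}"
  shows "rep.Z (Old_Arrow (Copy \<alpha> i)) (Old_Arrow (Copy \<beta> i)) \<longleftrightarrow> Z (Old_Arrow \<alpha>) (Old_Arrow \<beta>)"
proof -
  have "rep.Z (Old_Arrow (Copy \<alpha> i)) (Old_Arrow (Copy \<beta> i)) \<longleftrightarrow> zero_product A \<alpha> \<beta>"
    using assms by (subst rep_Z_Old_iff) (auto simp: repetition_relations_def)
  thus ?thesis using assms Z_Old_iff[of \<alpha> \<beta>] by (simp add: composable_def)
qed

lemma Z_Old_tau_copy:
  assumes "\<alpha> \<in> in_arcs (quiver A) v" "p \<in> labels" "tail G (tau B p) = Old v" "i \<in> {1..<k}"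
  shows "rep.Z (Old_Arrow (Copy \<alpha> i)) (Old_Arrow (Conn p i)) \<longleftrightarrow> Z (Old_Arrow \<alpha>) (tau B p)"
  using assms by (subst rep_Z_Old_iff) (auto simp: repetition_relations_def)

lemma Z_sigma_Old_copy:
  assumes "\<beta> \<in> out_arcs (quiver A) v" "p \<in> labels" "head G (sigma B p) = Old v" "i \<in> {1..<k}"
  shows "rep.Z (Old_Arrow (Conn p i)) (Old_Arrow (Copy \<beta> (i + 1))) \<longleftrightarrow> Z (sigma B p) (Old_Arrow \<beta>)"
  using assms by (subst rep_Z_Old_iff) (auto simp: repetition_relations_def)

text \<open>If no arrow out of \<open>v\<close> shows a disagreement, then the numbering is kept
  and the entry at \<open>\<beta>\<close> agrees; if some arrow \<open>\<gamma>\<close> does, then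
  exchanging the two new arrows reverses the entry at \<open>\<gamma>\<close>.\<close>

lemma swap_sources_correct:
  assumes v: "v \<in> verts (quiver A)" and deg: "in_degree (quiver A) v = 0"
    and b: "\<beta> \<in> out_arcs (quiver A) v"
  shows "\<exists>x\<in>in_arcs G (Old v). \<exists>y\<in>out_arcs G (Old v). Z x y \<longleftrightarrow> rep.Z (in_copy 1 x) (out_copy 1 y)"
proof -
  have mem: "New_In v 0 \<in> in_arcs G (Old v)" using v deg by simp
  show ?thesis
  proof (cases "swap_sources v")
    case False
    hence "Z (New_In v 0) (Old_Arrow \<beta>) \<longleftrightarrow> rep.Z (in_copy 1 (New_In v 0)) (out_copy 1 (Old_Arrow \<beta>))"
      using deg b unfolding swap_sources_def in_copy_New_In by auto
    thus ?thesis using mem b by (intro bexI[of _ "New_In v 0"] bexI[of _ "Old_Arrow \<beta>"]) auto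
  next
    case True
    then obtain \<gamma> where g: "\<gamma> \<in> out_arcs (quiver A) v"
      "Z (New_In v 0) (Old_Arrow \<gamma>) \<noteq> rep.Z (New_In (v, 1) 0) (Old_Arrow (Copy \<gamma> 1))"
      unfolding swap_sources_def by blast
    have "rep.Z (New_In (v, 1) 1) (Old_Arrow (Copy \<gamma> 1)) \<longleftrightarrow> \<not> rep.Z (New_In (v, 1) 0) (Old_Arrow (Copy \<gamma> 1))"
      using v deg g(1) k in_degree_first_layer[of v] by (intro rep.Z_other_in[of _ "(v, 1)"]) auto
    hence "Z (New_In v 0) (Old_Arrow \<gamma>) \<longleftrightarrow> rep.Z (in_copy 1 (New_In v 0)) (out_copy 1 (Old_Arrow \<gamma>))"
      using g(2) True by (simp add: in_copy_New_In[unfolded One_nat_def])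
    thus ?thesis using mem g(1) by (intro bexI[of _ "New_In v 0"] bexI[of _ "Old_Arrow \<gamma>"]) auto
  qed
qed

lemma swap_sinks_correct:
  assumes v: "v \<in> verts (quiver A)" and deg: "out_degree (quiver A) v = 0"
    and b: "\<alpha> \<in> in_arcs (quiver A) v"
  shows "\<exists>x\<in>in_arcs G (Old v). \<exists>y\<in>out_arcs G (Old v). Z x y \<longleftrightarrow> rep.Z (in_copy k x) (out_copy k y)"
proof -
  have mem: "New_Out v 0 \<in> out_arcs G (Old v)" using v deg by simp
  show ?thesis
  proof (cases "swap_sinks v")
    case False
    hence "Z (Old_Arrow \<alpha>) (New_Out v 0) \<longleftrightarrow> rep.Z (in_copy k (Old_Arrow \<alpha>)) (out_copy k (New_Out v 0))"
      using deg b unfolding swap_sinks_def out_copy_New_Out by auto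
    thus ?thesis using mem b by (intro bexI[of _ "New_Out v 0"] bexI[of _ "Old_Arrow \<alpha>"]) auto
  next
    case True
    then obtain \<gamma> where g: "\<gamma> \<in> in_arcs (quiver A) v"
      "Z (Old_Arrow \<gamma>) (New_Out v 0) \<noteq> rep.Z (Old_Arrow (Copy \<gamma> k)) (New_Out (v, k) 0)"
      unfolding swap_sinks_def by blast
    have "rep.Z (Old_Arrow (Copy \<gamma> k)) (New_Out (v, k) 1) \<longleftrightarrow> \<not> rep.Z (Old_Arrow (Copy \<gamma> k)) (New_Out (v, k) 0)"
      using v deg g(1) k out_degree_last_layer[of v] by (intro rep.Z_other_out[of _ "(v, k)"]) auto
    hence "Z (Old_Arrow \<gamma>) (New_Out v 0) \<longleftrightarrow> rep.Z (in_copy k (Old_Arrow \<gamma>)) (out_copy k (New_Out v 0))"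
      using g(2) True by (simp add: out_copy_New_Out[of v 0])
    thus ?thesis using mem g(1) by (intro bexI[of _ "New_Out v 0"] bexI[of _ "Old_Arrow \<gamma>"]) auto
  qed
qed

text \<open>As \<open>v\<close> is not isolated in \<open>A\<close>, it has an incoming or an
  outgoing arrow in \<open>A\<close>. Together with an arrow on the other side, this gives an
  entry that is either fixed by the relations of the repetition or, at new arrows in the first and
  the last layer, arranged by the exchange of numbers.\<close>

lemma ex_Z_copy_agrees:
  assumes v: "v \<in> verts (quiver A)" and i: "i \<in> {1..k}"
  shows "\<exists>x\<in>in_arcs G (Old v). \<exists>y\<in>out_arcs G (Old v). Z x y \<longleftrightarrow> rep.Z (in_copy i x) (out_copy i y)"
proof -
  consider (both) \<alpha> \<beta> where "\<alpha> \<in> in_arcs (quiver A) v" "\<beta> \<in> out_arcs (quiver A) v"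
    | (ins) \<alpha> where "\<alpha> \<in> in_arcs (quiver A) v" "out_arcs (quiver A) v = {}"
    | (outs) \<beta> where "\<beta> \<in> out_arcs (quiver A) v" "in_arcs (quiver A) v = {}"
    using incident[OF v] by (metis equals0I in_in_arcs_conv in_out_arcs_conv)
  thus ?thesis
  proof cases
    case both
    thus ?thesis using Z_Old_Old_copy[OF both i]
      by (intro bexI[of _ "Old_Arrow \<alpha>"] bexI[of _ "Old_Arrow \<beta>"]) auto
  next
    case ins
    hence deg: "out_degree (quiver A) v = 0" by (simp add: out_degree_def)
    show ?thesis
    proof (cases "i = k")
      case True
      thus ?thesis using swap_sinks_correct[OF v deg ins(1)] by simp
    next
      case False
      have New: "New_Out v 0 \<in> arcs G" using deg v by simp
      obtain p where p: "p \<in> labels" "tau B p = New_Out v 0" by (rule New_Out_eq_tau[OF New])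
      have "Z (Old_Arrow \<alpha>) (tau B p) \<longleftrightarrow> rep.Z (in_copy i (Old_Arrow \<alpha>)) (out_copy i (tau B p))"
        using Z_Old_tau_copy[OF ins(1) p(1), of i] p i False out_copy_tau[OF p(1) False] by simp
      thus ?thesis using ins(1) New p(2) by (intro bexI[of _ "Old_Arrow \<alpha>"] bexI[of _ "tau B p"]) auto
    qed
  next
    case outs
    hence deg: "in_degree (quiver A) v = 0" by (simp add: in_degree_def)
    show ?thesis
    proof (cases "i = 1")
      case True
      thus ?thesis using swap_sources_correct[OF v deg outs(1)] by simp
    next
      case False
      have New: "New_In v 0 \<in> arcs G" using deg v by simp
      obtain p where p: "p \<in> labels" "sigma B p = New_In v 0" by (rule New_In_eq_sigma[OF New])
      have "i - 1 \<in> {1..<k}" "i - 1 + 1 = i" using i False by auto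
      hence "Z (sigma B p) (Old_Arrow \<beta>) \<longleftrightarrow> rep.Z (in_copy i (sigma B p)) (out_copy i (Old_Arrow \<beta>))"
        using Z_sigma_Old_copy[OF outs(1) p(1), of "i - 1"] p in_copy_sigma[OF p(1) False] by simp
      thus ?thesis using outs(1) New p(2) by (intro bexI[of _ "sigma B p"] bexI[of _ "Old_Arrow \<beta>"]) auto
    qed
  qed
qed

text \<open>One entry agrees, and by \<open>Z_checkerboard\<close> in both quivers it determines
  all of them.\<close>

lemma Z_copy_iff:
  assumes x: "x \<in> in_arcs G (Old v)" and y: "y \<in> out_arcs G (Old v)" and i: "i \<in> {1..k}"
  shows "rep.Z (in_copy i x) (out_copy i y) \<longleftrightarrow> Z x y"
proof -
  have v: "v \<in> verts (quiver A)" using x head_in_verts by auto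
  obtain a b where ab: "a \<in> in_arcs G (Old v)" "b \<in> out_arcs G (Old v)"
    "Z a b \<longleftrightarrow> rep.Z (in_copy i a) (out_copy i b)"
    using ex_Z_copy_agrees[OF v i] by blast
  have "in_copy i x = in_copy i a \<longleftrightarrow> x = a" "out_copy i y = out_copy i b \<longleftrightarrow> y = b"
    using in_copy_inject[OF x ab(1)] out_copy_inject[OF y ab(2)] by blast+
  note eqs = this
  have "rep.Z (in_copy i x) (out_copy i y) \<longleftrightarrow> (rep.Z (in_copy i a) (out_copy i b) \<longleftrightarrow>
      (in_copy i x = in_copy i a \<longleftrightarrow> out_copy i y = out_copy i b))"
    by (rule rep.Z_checkerboard[OF in_copy_in_arcs[OF x i] in_copy_in_arcs[OF ab(1) i]
        out_copy_out_arcs[OF y i] out_copy_out_arcs[OF ab(2) i]])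
  also have "\<dots> \<longleftrightarrow> (Z a b \<longleftrightarrow> (x = a \<longleftrightarrow> y = b))"
    by (simp only: eqs ab(3))
  also have "\<dots> \<longleftrightarrow> Z x y"
    by (rule Z_checkerboard[OF x ab(1) y ab(2), symmetric])
  finally show ?thesis .
qed

lemma composable_at_Old:
  assumes "composable (blossomed B) x y"
  obtains v where "x \<in> in_arcs G (Old v)" "y \<in> out_arcs G (Old v)"
proof -
  have *: "head G x = tail G y" "x \<in> arcs G" "y \<in> arcs G" using assms by (simp_all add: composable_def)
  have "\<exists>v. tail G y = Old v"
  proof (cases y)
    case (New_In v i)
    thus ?thesis using *(1) by (cases x) simp_all
  qed simp_all
  thus ?thesis using that * by auto
qed

lemma Z_copy:
  assumes "Z x y" "i \<in> {1..k}"
  shows "rep.Z (in_copy i x) (out_copy i y)"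
proof -
  obtain v where v: "x \<in> in_arcs G (Old v)" "y \<in> out_arcs G (Old v)"
    by (rule composable_at_Old[OF composable_if_Z[OF assms(1)]])
  show ?thesis using Z_copy_iff[OF v assms(2)] assms(1) by simp
qed

lemma N_copy:
  assumes "N x y" "i \<in> {1..k}"
  shows "rep.N (in_copy i x) (out_copy i y)"
proof -
  obtain v where v: "x \<in> in_arcs G (Old v)" "y \<in> out_arcs G (Old v)"
    by (rule composable_at_Old[OF composable_if_N[OF assms(1)]])
  have "\<not> rep.Z (in_copy i x) (out_copy i y)"
    using Z_copy_iff[OF v assms(2)] N_iff_not_Z[OF composable_if_N[OF assms(1)]] assms(1) by simp
  thus ?thesis
    using rep.N_iff_not_Z[of "in_copy i x" "out_copy i y"]
      in_copy_in_arcs[OF v(1) assms(2)] out_copy_out_arcs[OF v(2) assms(2)]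
    by (simp add: composable_def)
qed

text \<open>Apart from its two ends, a thread consists of old arrows, and on these
  \<open>in_copy\<close> and \<open>out_copy\<close> agree, so that the copies of its steps fit
  together.\<close>

lemma thread_copy:
  assumes comp: "\<And>x y. R x y \<Longrightarrow> composable (blossomed B) x y"
    and copy: "\<And>x y. R x y \<Longrightarrow> R' (in_copy i x) (out_copy i y)"
  shows "(R ^^ Suc m) x y \<Longrightarrow> (R' ^^ Suc m) (in_copy i x) (out_copy i y)"
proof (induction m arbitrary: x)
  case 0
  thus ?case using copy by (simp only: relpowp_Suc_0)
next
  case (Suc m)
  from Suc.prems obtain w where w: "R x w" "(R ^^ Suc m) w y" by (rule relpowp_Suc_E2)
  from w(2) obtain z where z: "R w z" by (rule relpowp_Suc_E2)
  obtain \<alpha> where "w = Old_Arrow \<alpha>" by (rule interior_Old[OF comp[OF w(1)] comp[OF z]])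
  hence "out_copy i w = in_copy i w" by simp
  thus ?case using relpowp_Suc_I2[OF _ Suc.IH[OF w(2)], of "in_copy i x"] copy[OF w(1)] by simp
qed

text \<open>The threads of consecutive layers are joined at connecting arrows: the one with label
  \<open>r\<close> from layer \<open>i\<close> is both the last arrow \<open>out_copy i
  (\<tau>\<^sub>r)\<close> of a thread in layer \<open>i\<close> and the first arrow
  \<open>in_copy (i + 1) (\<sigma>\<^sub>r)\<close> of a thread in layer \<open>i + 1\<close>.
  Here \<open>f p\<close> is the label at which the thread to \<open>p\<close> starts, so that the
  statement covers \<open>Z\<close> with \<open>f = \<Phi>\<close> and \<open>N\<close> with
  \<open>f = id\<close>. The induction starts at the last layer and adds one layer at the front in
  each step.\<close>

lemma thread_through_layers:
  assumes comp: "\<And>x y. R x y \<Longrightarrow> composable (blossomed B) x y"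
    and copy: "\<And>i x y. R x y \<Longrightarrow> i \<in> {1..k} \<Longrightarrow> R' (in_copy i x) (out_copy i y)"
    and f: "\<And>p. p \<in> labels \<Longrightarrow> f p \<in> labels"
    and thread: "\<And>p. p \<in> labels \<Longrightarrow> (R ^^ Suc (len p)) (sigma B (f p)) (tau B p)"
    and p: "p \<in> labels" and "j < k"
  shows "(R' ^^ (\<Sum>i<Suc j. Suc (len ((f ^^ i) p)))) (in_copy (k - j) (sigma B ((f ^^ Suc j) p)))
    (out_copy k (tau B p))"
  using \<open>j < k\<close>
proof (induction j)
  case 0
  show ?case using thread_copy[where R=R and R'=R' and i=k, OF comp copy thread[OF p]] k by simp
next
  case (Suc j)
  let ?p = "(f ^^ Suc j) p" and ?i = "k - Suc j"
  have "(f ^^ n) p \<in> labels" for n by (induction n) (use f p in auto)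
  hence p': "?p \<in> labels" by blast
  have i: "?i \<in> {1..k}" "?i \<noteq> k" "k - j \<noteq> 1" "k - j - 1 = ?i" using Suc.prems by auto
  have "(R' ^^ Suc (len ?p)) (in_copy ?i (sigma B (f ?p))) (out_copy ?i (tau B ?p))"
    using thread_copy[where R=R and R'=R' and i="?i", OF comp copy[OF _ i(1)] thread[OF p']] .
  moreover have "out_copy ?i (tau B ?p) = in_copy (k - j) (sigma B ?p)"
    using out_copy_tau[OF p' i(2)] in_copy_sigma[OF p' i(3)] i(4) by simp
  ultimately have step: "(R' ^^ (Suc (len ?p) + (\<Sum>i<Suc j. Suc (len ((f ^^ i) p)))))
      (in_copy ?i (sigma B (f ?p))) (out_copy k (tau B p))"
    using Suc.IH Suc.prems by (intro relpowp_trans[of "Suc (len ?p)"]) auto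
  have sum: "Suc (len ?p) + (\<Sum>i<Suc j. Suc (len ((f ^^ i) p))) =
      (\<Sum>i<Suc (Suc j). Suc (len ((f ^^ i) p)))"
    by (simp only: sum.lessThan_Suc[of _ "Suc j"] add.commute)
  have "f ?p = (f ^^ Suc (Suc j)) p" by simp
  with step show ?case unfolding sum by (simp only:)
qed

lemma Z_thread_repetition:
  assumes "p \<in> labels"
  shows "(rep.Z ^^ (\<Sum>i<k. Suc (AG_length ((AG_perm A B ^^ i) p))))
    (in_copy 1 (sigma B ((AG_perm A B ^^ k) p))) (out_copy k (tau B p))"
proof -
  obtain j where j: "k = Suc j" using k by (cases k) auto
  show ?thesis
    using thread_through_layers[of Z rep.Z "AG_perm A B" AG_length p j, OF composable_if_Z Z_copy
        AG_perm_in_labels AG_delta_thread assms] j by simp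
qed

lemma N_thread_repetition:
  assumes "p \<in> labels"
  shows "\<exists>m. (rep.N ^^ m) (in_copy 1 (sigma B p)) (out_copy k (tau B p))"
proof -
  obtain j where j: "k = Suc j" using k by (cases k) auto
  have "\<exists>m. (N ^^ Suc m) (sigma B r) (tau B r)" if "r \<in> labels" for r
  proof -
    obtain m where m: "(N ^^ m) (sigma B r) (tau B r)" using N_thread[OF \<open>r \<in> labels\<close>] by blast
    thus ?thesis using sigma_neq_tau[OF that that] by (cases m) auto
  qed
  then obtain len where len: "\<And>r. r \<in> labels \<Longrightarrow> (N ^^ Suc (len r)) (sigma B r) (tau B r)" by metis
  have "(rep.N ^^ (\<Sum>i<Suc j. Suc (len ((id ^^ i) p)))) (in_copy (k - j) (sigma B ((id ^^ Suc j) p)))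
      (out_copy k (tau B p))"
    by (rule thread_through_layers[of N rep.N id len p j, OF composable_if_N N_copy _ _ assms])
      (use len j in simp_all)
  moreover have "k - j = 1" "(id ^^ Suc j) p = p" using j by simp_all
  ultimately show ?thesis by metis
qed

text \<open>In later layers the two arrows into a vertex of the blossoming of \<open>A\<close>
  have copies among the arrows of the repetition, so that no new incoming arrow is added.\<close>

lemma source_in_first_layer:
  assumes "New_In (v, i) j \<in> arcs rep.G"
  shows "i = 1"
proof (rule ccontr)
  assume i: "i \<noteq> 1"
  interpret QQ: fin_digraph Q\<^sub>k by (rule fin_digraph_repetition)
  have v: "v \<in> verts (quiver A)" "i \<in> {1..k}" using assms by auto
  let ?S = "Old_Arrow ` in_arcs Q\<^sub>k (v, i) :: ('v \<times> nat, 'a repetition_arrow) blossom_arrow set"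
  have "in_copy i ` in_arcs G (Old v) \<subseteq> ?S"
  proof
    fix y assume "y \<in> in_copy i ` in_arcs G (Old v)"
    then obtain x where x: "x \<in> in_arcs G (Old v)" "y = in_copy i x" by blast
    have "\<exists>z. y = Old_Arrow z"
    proof (cases x)
      case (New_In w j)
      obtain p where "p \<in> labels" "sigma B p = New_In w j" using New_In_eq_sigma[of w j] x New_In by auto
      thus ?thesis using in_copy_sigma[of p i] i x New_In by auto
    qed (use x in auto)
    thus "y \<in> ?S" using in_copy_in_arcs[OF x(1) v(2)] x(2) by auto
  qed
  hence "card (in_copy i ` in_arcs G (Old v)) \<le> card (?S)"
    by (rule card_mono[OF finite_imageI[OF QQ.finite_in_arcs]])
  moreover have "card (in_copy i ` in_arcs G (Old v)) = 2"
    using card_in_arcs_G[OF v(1)] in_copy_inject by (subst card_image) (auto intro: inj_onI)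
  moreover have "card (?S) = in_degree Q\<^sub>k (v, i)"
    by (simp add: card_image inj_on_def in_degree_def)
  ultimately show False using assms by simp
qed

lemma bij_betw_in_copy_sigma:
  "bij_betw (\<lambda>p. in_copy 1 (sigma B p)) labels {x \<in> arcs rep.G. x \<in> range (case_prod New_In)}"
proof (rule bij_betwI')
  fix p r assume p: "p \<in> labels" and r: "r \<in> labels"
  show "in_copy 1 (sigma B p) = in_copy 1 (sigma B r) \<longleftrightarrow> p = r"
  proof
    assume eq: "in_copy 1 (sigma B p) = in_copy 1 (sigma B r)"
    obtain v i where vi: "sigma B p = New_In v i" "New_In v i \<in> arcs G" by (rule sigma_eq[OF p])
    obtain w j where wj: "sigma B r = New_In w j" "New_In w j \<in> arcs G" by (rule sigma_eq[OF r])
    have "w = v" using eq unfolding vi wj in_copy_New_In by simp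
    hence "sigma B p = sigma B r" using vi wj eq by (intro in_copy_inject[of _ v _ 1]) auto
    thus "p = r" using sigma_inject[OF p r] by simp
  qed simp
next
  fix p assume p: "p \<in> labels"
  obtain v i where vi: "sigma B p = New_In v i" "New_In v i \<in> arcs G" by (rule sigma_eq[OF p])
  thus "in_copy 1 (sigma B p) \<in> {x \<in> arcs rep.G. x \<in> range (case_prod New_In)}"
    using in_copy_in_arcs[of "sigma B p" v 1] k by (auto simp: in_copy_New_In[unfolded One_nat_def])
next
  fix x assume "x \<in> {x \<in> arcs rep.G. x \<in> range (case_prod New_In)}"
  then obtain v i j where x: "x = New_In (v, i) j" "New_In (v, i) j \<in> arcs rep.G" by auto
  have i: "i = 1" by (rule source_in_first_layer[OF x(2)])
  define j' where "j' = (if swap_sources v then 1 - j else j)"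
  have "New_In v j' \<in> arcs G" and "in_copy 1 (New_In v j') = x"
    using x i in_degree_first_layer[of v]
    by (auto simp: j'_def in_copy_New_In swap_sources_def simp del: One_nat_def)
  thus "\<exists>p\<in>labels. x = in_copy 1 (sigma B p)" using New_In_eq_sigma[of v j'] by metis
qed

text \<open>The two labellings are matched along the new sources. Then they also match along the
  new sinks, because both labellings follow the \<open>N\<close>-threads.\<close>

lemma ex_matching_labels:
  "\<exists>g. bij_betw g labels rep.labels \<and>
    (\<forall>p\<in>labels. sigma C (g p) = in_copy 1 (sigma B p) \<and> tau C (g p) = out_copy k (tau B p))"
proof -
  define g where "g = inv_into rep.labels (sigma C) \<circ> (\<lambda>p. in_copy 1 (sigma B p))"
  have g: "bij_betw g labels rep.labels"
    unfolding g_def by (rule bij_betw_trans[OF bij_betw_in_copy_sigma bij_betw_inv_into[OF rep.bij_betw_sigma]])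
  have s: "sigma C (g p) = in_copy 1 (sigma B p)" if "p \<in> labels" for p
  proof -
    have "in_copy 1 (sigma B p) \<in> sigma C ` rep.labels"
      unfolding bij_betw_imp_surj_on[OF rep.bij_betw_sigma]
      using bij_betw_apply[OF bij_betw_in_copy_sigma that] .
    thus ?thesis by (simp add: g_def f_inv_into_f)
  qed
  have "tau C (g p) = out_copy k (tau B p)" if p: "p \<in> labels" for p
  proof -
    have gp: "g p \<in> rep.labels" using bij_betw_apply[OF g p] .
    obtain m where m: "(rep.N ^^ m) (sigma C (g p)) (out_copy k (tau B p))"
      using N_thread_repetition[OF p] s[OF p] by auto
    obtain n where n: "(rep.N ^^ n) (sigma C (g p)) (tau C (g p))"
      using rep.N_thread[OF gp] by blast
    obtain v i where "tau B p = New_Out v i" by (rule tau_eq[OF p])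
    hence "\<nexists>y. rep.N (out_copy k (tau B p)) y" using rep.no_succ_New_Out by (simp add: out_copy_New_Out)
    thus ?thesis
      using relpowp_terminal_unique[of rep.N n _ "tau C (g p)" m] m n rep.no_succ_tau(2)[OF gp]
        rep.bi_unique_N by (simp add: bi_unique_alt_def)
  qed
  thus ?thesis using g s by blast
qed

text \<open>The label \<open>p\<close> is counted on the left if the \<open>Z\<close>-thread of
  the repetition that ends at \<open>p\<close> also starts there and has the right length; that
  thread is known from \<open>Z_thread_repetition\<close>.\<close>

lemma AG_number_repetition:
  "AG_number (repetition A B k) C 1 l =
    card {p \<in> labels. (AG_perm A B ^^ k) p = p \<and> (\<Sum>i<k. AG_length ((AG_perm A B ^^ i) p)) + k = Suc l}"
proof -
  let ?\<Phi> = "AG_perm A B"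
  obtain g where "bij_betw g labels rep.labels \<and>
    (\<forall>p\<in>labels. sigma C (g p) = in_copy 1 (sigma B p) \<and> tau C (g p) = out_copy k (tau B p))"
    using ex_matching_labels by (rule exE)
  hence g: "bij_betw g labels rep.labels"
    "\<And>p. p \<in> labels \<Longrightarrow> sigma C (g p) = in_copy 1 (sigma B p)"
    "\<And>p. p \<in> labels \<Longrightarrow> tau C (g p) = out_copy k (tau B p)" by (simp_all del: One_nat_def)
  have gl: "g p \<in> rep.labels" if "p \<in> labels" for p using bij_betw_apply[OF g(1) that] .
  have iff: "(rep.Z ^^ Suc l) (sigma C (g p)) (tau C (g p)) \<longleftrightarrow>
      (?\<Phi> ^^ k) p = p \<and> (\<Sum>i<k. AG_length ((?\<Phi> ^^ i) p)) + k = Suc l" (is "?L \<longleftrightarrow> ?R")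
    if p: "p \<in> labels" for p
  proof -
    have pk: "(?\<Phi> ^^ n) p \<in> labels" for n by (induction n) (use p AG_perm_in_labels in auto)
    have sum: "(\<Sum>i<k. Suc (AG_length ((?\<Phi> ^^ i) p))) = (\<Sum>i<k. AG_length ((?\<Phi> ^^ i) p)) + k"
      by (subst sum_Suc) simp
    have th: "(rep.Z ^^ ((\<Sum>i<k. AG_length ((?\<Phi> ^^ i) p)) + k)) (sigma C (g ((?\<Phi> ^^ k) p))) (tau C (g p))"
      using Z_thread_repetition[OF p] unfolding sum g(2)[OF pk] g(3)[OF p] .
    show ?thesis
    proof
      assume ?L
      have "(\<Sum>i<k. AG_length ((?\<Phi> ^^ i) p)) + k = Suc l \<and> g p = g p \<and> g ((?\<Phi> ^^ k) p) = g p"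
        by (rule rep.Z_thread_unique[OF th \<open>?L\<close> _ gl[OF p] gl[OF p] gl[OF pk] gl[OF p]]) simp
      moreover have "inj_on g labels" using g(1) by (simp add: bij_betw_def)
      ultimately show ?R using inj_onD[OF _ _ pk p] by blast
    next
      assume R: ?R
      show ?L using th unfolding conjunct1[OF R] conjunct2[OF R] .
    qed
  qed
  have "bij_betw g {p \<in> labels. (?\<Phi> ^^ k) p = p \<and> (\<Sum>i<k. AG_length ((?\<Phi> ^^ i) p)) + k = Suc l}
      {p \<in> rep.labels. (rep.Z ^^ Suc l) (sigma C p) (tau C p)}"
    by (rule bij_betw_Collect[OF g(1)]) (rule iff)
  from bij_betw_same_card[OF this] show ?thesis
    unfolding rep.AG_number_1 by (rule sym)
qed

end

theorem proposition4p3: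
  fixes A :: "('v, 'a, 'k::alg_closed_field) bound_quiver"
    and B :: "('v, 'a, 'k) blossoming"
    and B_rep :: "nat \<Rightarrow> ('v \<times> nat, 'a repetition_arrow, 'k) blossoming"
    and q l :: nat
  assumes "gentle A"
    and "connected (quiver A)"
    and "arcs (quiver A) \<noteq> {}"
    and "labelled_blossoming A B"
    and "\<And>k. k \<ge> 1 \<Longrightarrow> labelled_blossoming (repetition A B k) (B_rep k)"
    and "q \<ge> 1"
  shows "real (AG_number A B q l) =
    1 / real q *
      (\<Sum>c | c dvd gcd q l.
         real_of_int (moebius c) *
         real (AG_number (repetition A B (q div c)) (B_rep (q div c)) 1 ((q + l) div c - 1)))"
proof -
  have fin: "fin_digraph (quiver A)" using assms(1) by (simp add: gentle_def locally_gentle_def)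
  interpret bq: blossomed_quiver A B
  proof (rule blossomed_quiver.intro)
    fix v assume "v \<in> verts (quiver A)"
    thus "\<exists>\<alpha>\<in>arcs (quiver A). tail (quiver A) \<alpha> = v \<or> head (quiver A) \<alpha> = v"
      using assms(2,3) fin by (intro connected_imp_incident) (auto simp: fin_digraph_def)
  qed (use fin assms(4) in auto)
  let ?\<Phi> = "AG_perm A B" and ?P = "{1..defect A}"
  define w where "w = (\<lambda>p. length (snd (AG_delta A B p)))"
  define g where "g = (\<lambda>n. real (card {p \<in> ?P. card (orbit ?\<Phi> p) = q div n \<and> sum w (orbit ?\<Phi> p) = l div n}))"
  have rep: "real (AG_number (repetition A B (q div c)) (B_rep (q div c)) 1 ((q + l) div c - 1)) =
      (\<Sum>e | e dvd gcd q l div c. g (c * e))" if c: "c dvd gcd q l" for c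
  proof -
    let ?k = "q div c" and ?m = "l div c"
    have dvd: "c dvd q" "c dvd l" using c by auto
    have k: "?k \<ge> 1" using dvd assms(6) by (auto elim!: dvdE)
    interpret br: blossomed_repetition A B ?k "B_rep ?k"
      using k assms(5) by unfold_locales auto
    \<comment> \<open>The \<open>?k - 1\<close> connecting arrows account for the shift from \<open>l div c\<close> to \<open>(q + l) div c - 1\<close>.\<close>
    have len: "(q + l) div c = ?k + ?m" using dvd by (simp add: div_add)
    have "AG_number (repetition A B ?k) (B_rep ?k) 1 ((q + l) div c - 1) =
        card {p \<in> ?P. (?\<Phi> ^^ ?k) p = p \<and> (\<Sum>i<?k. w ((?\<Phi> ^^ i) p)) = ?m}"
      unfolding br.AG_number_repetition w_def len using k by (intro arg_cong[where f=card]) auto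
    also have "\<dots> = (\<Sum>e | e dvd gcd ?k ?m. card {p \<in> ?P. card (orbit ?\<Phi> p) = ?k div e \<and> sum w (orbit ?\<Phi> p) = ?m div e})"
      using k by (intro card_fixed_points_funpow bq.bij_betw_AG_perm) auto
    also have "gcd ?k ?m = gcd q l div c"
    proof -
      have "c * gcd ?k ?m = gcd q l" using dvd by (simp add: gcd_mult_distrib_nat)
      moreover have "c > 0" using dvd(1) assms(6) by (auto intro: Nat.gr0I)
      ultimately show ?thesis by (metis nonzero_mult_div_cancel_left not_gr0)
    qed
    finally show ?thesis by (simp add: g_def div_mult2_eq)
  qed
  have "(\<Sum>c | c dvd gcd q l. real_of_int (moebius c) *
         real (AG_number (repetition A B (q div c)) (B_rep (q div c)) 1 ((q + l) div c - 1))) =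
      (\<Sum>c | c dvd gcd q l. real_of_int (moebius c) * (\<Sum>e | e dvd gcd q l div c. g (c * e)))"
    using rep by (intro sum.cong) auto
  also have "\<dots> = g 1" using assms(6) by (intro moebius_inversion_divisors) auto
  also have "\<dots> = real q * real (AG_number A B q l)"
    using bq.mult_AG_number[of q l] by (simp add: g_def w_def flip: of_nat_mult)
  finally show ?thesis using assms(6) by (simp add: field_simps)
qed

end
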